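(* Let $\Gamma$ be a countable sofic group with a sofic approximation $\Sigma$, and let $\pi\colon X\to Y$ be a factor map between dynamical systems $\Gamma\curvearrowright X$ and $\Gamma\curvearrowright Y$. For any dynamically generating continuous pseudometrics $\rho_X$ and $\rho_Y$ on $X$ and $Y$ respectively, $$\mathrm{mdim}_{\Sigma,\mathrm M}(\rho_X|\rho_Y)=\mathrm{mdim}_{\Sigma,\mathrm M}(\rho_X|Y).$$
   Context: $\Gamma$ is a countable discrete group; $\mathcal F(\Gamma)$ is the collection of nonempty finite subsets of $\Gamma$. A dynamical system $\Gamma\curvearrowright X$ is a continuous action on a compact metrizable space $X$; a factor map is a surjective continuous $\Gamma$-equivariant map. $[d]=\{1,\dots,d\}$. A pseudometric $\rho$ on $X$ is dynamically generating if $\sup_{s\in\Gamma}\rho(sx,sx')>0$ for all distinct $x,x'\in X$. Sofic approximation: a sequence of maps $\Sigma=\{\sigma_i\colon\Gamma\to\mathrm{Sym}(d_i)\}_{i\in\mathbb N}$ (not necessarily homomorphisms; write $\sigma_{i,s}=\sigma_i(s)$) with (1) $|\{v\in[d_i]:\sigma_{i,s}\sigma_{i,t}(v)=\sigma_{i,st}(v)\}|/d_i\to1$ for all $s,t\in\Gamma$; (2) $|\{v\in[d_i]:\sigma_{i,s}(v)\ne\sigma_{i,t}(v)\}|/d_i\to1$ for all distinct $s,t$; (3) $d_i\to\infty$. $\Gamma$ is sofic if it has a sofic approximation. For a continuous pseudometric $\rho$ on $Z$ and $\varphi,\psi\in Z^{[d]}$: $\rho_{2}(\varphi,\psi)=\big(\frac1d\sum_{v}\rho(\varphi(v),\psi(v))^2\big)^{1/2}$,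 $\rho_{\infty}(\varphi,\psi)=\max_v\rho(\varphi(v),\psi(v))$; these are written $\rho_{X,2},\rho_{X,\infty}$ for $\rho=\rho_X$, etc. For $F\in\mathcal F(\Gamma)$, $\delta>0$, $\sigma\colon\Gamma\to\mathrm{Sym}(d)$, $$\mathrm{Map}(\rho_X,F,\delta,\sigma)=\{\varphi\colon[d]\to X:\ \rho_{X,2}(s\varphi,\varphi\circ\sigma(s))\le\delta\ \text{for all } s\in F\},\quad (s\varphi)(v)=s(\varphi(v)).$$ For $\mathcal K\subseteq X^{[d]}$ and $\varepsilon,\theta>0$: $N_\varepsilon(\mathcal K,\theta,\rho_{X,\infty}|\rho_{Y,\infty})$ is the maximal cardinality of a subset $\mathcal E\subseteq\mathcal K$ such that $\rho_{Y,\infty}(\pi\circ\varphi,\pi\circ\varphi')\le\theta$ and $\rho_{X,\infty}(\varphi,\varphi')\ge\varepsilon$ for all distinct $\varphi,\varphi'\in\mathcal E$; $N_\varepsilon(\mathcal K,\rho_{X,\infty}|Y)$ is the maximal cardinality of a subset $\mathcal E\subseteq\mathcal K$ such that $\pi\circ\varphi=\pi\circ\varphi'$ and $\rho_{X,\infty}(\varphi,\varphi')\ge\varepsilon$ for all distinct $\varphi,\varphi'\in\mathcal E$. Set $$h_\Sigma^\varepsilon(\rho_X|\rho_Y)=\inf_{\theta>0}\inf_{F\in\mathcal F(\Gamma)}\inf_{\delta>0}\limsup_{i\to\infty}\tfrac1{d_i}\log N_\varepsilon(\mathrm{Map}(\rho_X,F,\delta,\sigma_i),\theta,\rho_{X,\infty}|\rho_{Y,\infty}),$$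 $$h_\Sigma^\varepsilon(\rho_X|Y)=\inf_{F\in\mathcal F(\Gamma)}\inf_{\delta>0}\limsup_{i\to\infty}\tfrac1{d_i}\log N_\varepsilon(\mathrm{Map}(\rho_X,F,\delta,\sigma_i),\rho_{X,\infty}|Y),$$ (the $\limsup$ being $-\infty$ if the $\mathrm{Map}$ sets are empty for all large $i$), and $$\mathrm{mdim}_{\Sigma,\mathrm M}(\rho_X|\rho_Y)=\liminf_{\varepsilon\to0}\frac{h_\Sigma^\varepsilon(\rho_X|\rho_Y)}{\log(1/\varepsilon)},\qquad \mathrm{mdim}_{\Sigma,\mathrm M}(\rho_X|Y)=\liminf_{\varepsilon\to0}\frac{h_\Sigma^\varepsilon(\rho_X|Y)}{\log(1/\varepsilon)}.$$ *)

theory Defs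
  imports "HOL-Algebra.Group" "HOL-Analysis.Analysis" "HOL-Combinatorics.Permutations"
begin

definition dynamical_system ::
    "('g, 'm) monoid_scheme \<Rightarrow> 'x topology \<Rightarrow> ('g \<Rightarrow> 'x \<Rightarrow> 'x) \<Rightarrow> bool" where
  "dynamical_system G X a \<longleftrightarrow>
     compact_space X \<and> metrizable_space X \<and>
     continuous_map (prod_topology (discrete_topology (carrier G)) X) X (\<lambda>(s, x). a s x) \<and>
     (\<forall>x\<in>topspace X. a \<one>\<^bsub>G\<^esub> x = x) \<and>
     (\<forall>s\<in>carrier G. \<forall>t\<in>carrier G. \<forall>x\<in>topspace X. a (s \<otimes>\<^bsub>G\<^esub> t) x = a s (a t x))"

definition factor_map ::
    "('g, 'm) monoid_scheme \<Rightarrow> 'x topology \<Rightarrow> ('g \<Rightarrow> 'x \<Rightarrow> 'x) \<Rightarrow>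
     'y topology \<Rightarrow> ('g \<Rightarrow> 'y \<Rightarrow> 'y) \<Rightarrow> ('x \<Rightarrow> 'y) \<Rightarrow> bool" where
  "factor_map G X a Y b p \<longleftrightarrow>
     continuous_map X Y p \<and> p ` topspace X = topspace Y \<and>
     (\<forall>s\<in>carrier G. \<forall>x\<in>topspace X. p (a s x) = b s (p x))"

definition continuous_pseudometric :: "'x topology \<Rightarrow> ('x \<Rightarrow> 'x \<Rightarrow> real) \<Rightarrow> bool" where
  "continuous_pseudometric X \<rho> \<longleftrightarrow>
     (\<forall>x\<in>topspace X. \<forall>y\<in>topspace X. 0 \<le> \<rho> x y \<and> \<rho> x y = \<rho> y x) \<and>
     (\<forall>x\<in>topspace X. \<rho> x x = 0) \<and>
     (\<forall>x\<in>topspace X. \<forall>y\<in>topspace X. \<forall>z\<in>topspace X. \<rho> x z \<le> \<rho> x y + \<rho> y z) \<and>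
     continuous_map (prod_topology X X) euclideanreal (\<lambda>(x, y). \<rho> x y)"

definition dynamically_generating ::
    "('g, 'm) monoid_scheme \<Rightarrow> 'x topology \<Rightarrow> ('g \<Rightarrow> 'x \<Rightarrow> 'x) \<Rightarrow> ('x \<Rightarrow> 'x \<Rightarrow> real) \<Rightarrow> bool" where
  "dynamically_generating G X a \<rho> \<longleftrightarrow>
     (\<forall>x\<in>topspace X. \<forall>x'\<in>topspace X. x \<noteq> x' \<longrightarrow>
        0 < (SUP s\<in>carrier G. ereal (\<rho> (a s x) (a s x'))))"

text \<open>
  The map \<open>\<sigma> i s\<close> is a permutation of \<open>{1..d i}\<close>, extended by the identity to all of \<open>nat\<close>.
  Since \<open>d i\<close> tends to infinity, \<open>d i = 0\<close> is possible for finitely many \<open>i\<close> only, and these do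
  not affect any limit below.
\<close>

definition sofic_approximation ::
    "('g, 'm) monoid_scheme \<Rightarrow> (nat \<Rightarrow> nat) \<Rightarrow> (nat \<Rightarrow> 'g \<Rightarrow> nat \<Rightarrow> nat) \<Rightarrow> bool" where
  "sofic_approximation G d \<sigma> \<longleftrightarrow>
     (\<forall>i. \<forall>s\<in>carrier G. \<sigma> i s permutes {1..d i}) \<and>
     (\<forall>s\<in>carrier G. \<forall>t\<in>carrier G.
        (\<lambda>i. real (card {v \<in> {1..d i}. \<sigma> i s (\<sigma> i t v) = \<sigma> i (s \<otimes>\<^bsub>G\<^esub> t) v}) / real (d i))
          \<longlonglongrightarrow> 1) \<and>
     (\<forall>s\<in>carrier G. \<forall>t\<in>carrier G. s \<noteq> t \<longrightarrow>
        (\<lambda>i. real (card {v \<in> {1..d i}. \<sigma> i s v \<noteq> \<sigma> i t v}) / real (d i)) \<longlonglongrightarrow> 1) \<and>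
     filterlim d at_top sequentially"

definition dist2 :: "('z \<Rightarrow> 'z \<Rightarrow> real) \<Rightarrow> nat \<Rightarrow> (nat \<Rightarrow> 'z) \<Rightarrow> (nat \<Rightarrow> 'z) \<Rightarrow> real" where
  "dist2 \<rho> d \<phi> \<psi> = sqrt (1 / real d * (\<Sum>v\<in>{1..d}. (\<rho> (\<phi> v) (\<psi> v))\<^sup>2))"

definition distinf :: "('z \<Rightarrow> 'z \<Rightarrow> real) \<Rightarrow> nat \<Rightarrow> (nat \<Rightarrow> 'z) \<Rightarrow> (nat \<Rightarrow> 'z) \<Rightarrow> real" where
  "distinf \<rho> d \<phi> \<psi> = Max ((\<lambda>v. \<rho> (\<phi> v) (\<psi> v)) ` {1..d})"

text \<open>
  A map from \<open>{1..d}\<close> to \<open>X\<close> is an element of \<open>{1..d} \<rightarrow>\<^sub>E topspace X\<close>, so that equality of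
  functions is equality on \<open>{1..d}\<close>.
\<close>

definition sofic_Map ::
    "'x topology \<Rightarrow> ('g \<Rightarrow> 'x \<Rightarrow> 'x) \<Rightarrow> ('x \<Rightarrow> 'x \<Rightarrow> real) \<Rightarrow> 'g set \<Rightarrow> real \<Rightarrow>
     nat \<Rightarrow> ('g \<Rightarrow> nat \<Rightarrow> nat) \<Rightarrow> (nat \<Rightarrow> 'x) set" where
  "sofic_Map X a \<rho> F \<delta> d \<sigma> =
     {\<phi> \<in> {1..d} \<rightarrow>\<^sub>E topspace X. \<forall>s\<in>F. dist2 \<rho> d (\<lambda>v. a s (\<phi> v)) (\<phi> \<circ> \<sigma> s) \<le> \<delta>}"

text \<open>
  The supremum over finite sets in \<open>enat\<close> is the maximal cardinality whenever one exists, and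
  \<open>\<infinity>\<close> if there are arbitrarily large finite sets of the required kind.
\<close>

definition sep_near ::
    "('x \<Rightarrow> 'x \<Rightarrow> real) \<Rightarrow> ('y \<Rightarrow> 'y \<Rightarrow> real) \<Rightarrow> ('x \<Rightarrow> 'y) \<Rightarrow> nat \<Rightarrow> real \<Rightarrow>
     (nat \<Rightarrow> 'x) set \<Rightarrow> real \<Rightarrow> enat" where
  "sep_near \<rho>X \<rho>Y p d \<epsilon> K \<theta> =
     (SUP E \<in> {E. finite E \<and> E \<subseteq> K \<and>
                 (\<forall>\<phi>\<in>E. \<forall>\<phi>'\<in>E. \<phi> \<noteq> \<phi>' \<longrightarrow>
                    distinf \<rho>Y d (p \<circ> \<phi>) (p \<circ> \<phi>') \<le> \<theta> \<and> \<epsilon> \<le> distinf \<rho>X d \<phi> \<phi>')}.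
        enat (card E))"

text \<open>
  \<open>compose {1..d} p \<phi>\<close> is the composition as a function on \<open>{1..d}\<close> only.
\<close>

definition sep_fibre ::
    "('x \<Rightarrow> 'x \<Rightarrow> real) \<Rightarrow> ('x \<Rightarrow> 'y) \<Rightarrow> nat \<Rightarrow> real \<Rightarrow> (nat \<Rightarrow> 'x) set \<Rightarrow> enat" where
  "sep_fibre \<rho>X p d \<epsilon> K =
     (SUP E \<in> {E. finite E \<and> E \<subseteq> K \<and>
                 (\<forall>\<phi>\<in>E. \<forall>\<phi>'\<in>E. \<phi> \<noteq> \<phi>' \<longrightarrow>
                    compose {1..d} p \<phi> = compose {1..d} p \<phi>' \<and> \<epsilon> \<le> distinf \<rho>X d \<phi> \<phi>')}.
        enat (card E))"

text \<open>The value at \<open>0\<close> encodes the convention for empty sets of maps.\<close>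

definition elog :: "enat \<Rightarrow> ereal" where
  "elog n = (case n of enat k \<Rightarrow> if k = 0 then -\<infinity> else ereal (ln (real k)) | \<infinity> \<Rightarrow> \<infinity>)"

definition nonempty_finite_subsets :: "('g, 'm) monoid_scheme \<Rightarrow> 'g set set" where
  "nonempty_finite_subsets G = {F. F \<subseteq> carrier G \<and> finite F \<and> F \<noteq> {}}"

definition h_near ::
    "('g, 'm) monoid_scheme \<Rightarrow> (nat \<Rightarrow> nat) \<Rightarrow> (nat \<Rightarrow> 'g \<Rightarrow> nat \<Rightarrow> nat) \<Rightarrow>
     'x topology \<Rightarrow> ('g \<Rightarrow> 'x \<Rightarrow> 'x) \<Rightarrow> ('x \<Rightarrow> 'y) \<Rightarrow>
     ('x \<Rightarrow> 'x \<Rightarrow> real) \<Rightarrow> ('y \<Rightarrow> 'y \<Rightarrow> real) \<Rightarrow> real \<Rightarrow> ereal" where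
  "h_near G d \<sigma> X a p \<rho>X \<rho>Y \<epsilon> =
     (INF \<theta>\<in>{0<..}. INF F\<in>nonempty_finite_subsets G. INF \<delta>\<in>{0<..}.
        limsup (\<lambda>i. ereal (1 / real (d i)) *
          elog (sep_near \<rho>X \<rho>Y p (d i) \<epsilon> (sofic_Map X a \<rho>X F \<delta> (d i) (\<sigma> i)) \<theta>)))"

definition h_fibre ::
    "('g, 'm) monoid_scheme \<Rightarrow> (nat \<Rightarrow> nat) \<Rightarrow> (nat \<Rightarrow> 'g \<Rightarrow> nat \<Rightarrow> nat) \<Rightarrow>
     'x topology \<Rightarrow> ('g \<Rightarrow> 'x \<Rightarrow> 'x) \<Rightarrow> ('x \<Rightarrow> 'y) \<Rightarrow>
     ('x \<Rightarrow> 'x \<Rightarrow> real) \<Rightarrow> real \<Rightarrow> ereal" where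
  "h_fibre G d \<sigma> X a p \<rho>X \<epsilon> =
     (INF F\<in>nonempty_finite_subsets G. INF \<delta>\<in>{0<..}.
        limsup (\<lambda>i. ereal (1 / real (d i)) *
          elog (sep_fibre \<rho>X p (d i) \<epsilon> (sofic_Map X a \<rho>X F \<delta> (d i) (\<sigma> i)))))"

definition mdim_near ::
    "('g, 'm) monoid_scheme \<Rightarrow> (nat \<Rightarrow> nat) \<Rightarrow> (nat \<Rightarrow> 'g \<Rightarrow> nat \<Rightarrow> nat) \<Rightarrow>
     'x topology \<Rightarrow> ('g \<Rightarrow> 'x \<Rightarrow> 'x) \<Rightarrow> ('x \<Rightarrow> 'y) \<Rightarrow>
     ('x \<Rightarrow> 'x \<Rightarrow> real) \<Rightarrow> ('y \<Rightarrow> 'y \<Rightarrow> real) \<Rightarrow> ereal" where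
  "mdim_near G d \<sigma> X a p \<rho>X \<rho>Y =
     Liminf (at_right 0) (\<lambda>\<epsilon>. h_near G d \<sigma> X a p \<rho>X \<rho>Y \<epsilon> / ereal (ln (1 / \<epsilon>)))"

definition mdim_fibre ::
    "('g, 'm) monoid_scheme \<Rightarrow> (nat \<Rightarrow> nat) \<Rightarrow> (nat \<Rightarrow> 'g \<Rightarrow> nat \<Rightarrow> nat) \<Rightarrow>
     'x topology \<Rightarrow> ('g \<Rightarrow> 'x \<Rightarrow> 'x) \<Rightarrow> ('x \<Rightarrow> 'y) \<Rightarrow>
     ('x \<Rightarrow> 'x \<Rightarrow> real) \<Rightarrow> ereal" where
  "mdim_fibre G d \<sigma> X a p \<rho>X =
     Liminf (at_right 0) (\<lambda>\<epsilon>. h_fibre G d \<sigma> X a p \<rho>X \<epsilon> / ereal (ln (1 / \<epsilon>)))"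

end

theory Submission
  imports Defs
begin

text \<open>
  Fibrewise separation trivially implies separation with nearby images. Conversely, the fibres of
  \<open>p\<close> are upper semicontinuous: if the images of the points of a set \<open>A\<close> are close together, then
  some single fibre is near every point of \<open>A\<close>. Applied coordinatewise, this moves a family of maps
  with nearby images into one fibre while shrinking the separation from \<open>\<epsilon>\<close> to \<open>\<epsilon> / 2\<close>. As \<open>\<rho>Y\<close> is
  only dynamically generating, the images are close only at coordinates where the maps are nearly
  equivariant; the few remaining ones are handled by pigeonhole, at subexponential cost. So
  \<open>h_near\<close> at \<open>\<epsilon>\<close> is at most \<open>h_fibre\<close> at \<open>\<epsilon> / 2\<close>, and the factor \<open>2\<close> disappears on division by
  \<open>ln (1 / \<epsilon>)\<close>.
\<close>

section \<open>Compactness and upper semicontinuity of fibres\<close>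

text \<open>What needs care is the order of choices. The fibrewise data \<open>F\<close>,
  \<open>\<delta>\<close>, \<open>\<epsilon>\<close> and the cost \<open>\<gamma>\<close> are given;
  they fix how far points may move, hence a finite net and its number of labels. The net and
  \<open>\<gamma>\<close> fix the admissible density of defects, and only then are
  \<open>\<theta>\<close> and the finer equivariance conditions chosen. This is not circular, since
  the net depends only on the permitted displacement.

  A moved map must remain approximately equivariant, so displacement is measured together with its
  translates by \<open>F\<close>.

  Closeness in \<open>\<rho>Y\<close> at one coordinate says little about closeness in
  \<open>Y\<close>: the translates by several \<open>s\<close> are needed. At a coordinate
  \<open>v\<close> without defect, the translate by \<open>s\<close> is nearly the value at
  \<open>\<sigma> i s v\<close>, and nearness in the maximum distance is available at that shifted
  coordinate too.\<close>

lemma compact_family_control: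
  fixes g :: "'s \<Rightarrow> 'z \<Rightarrow> 'z \<Rightarrow> real" and f :: "'z \<Rightarrow> 'z \<Rightarrow> real"
  assumes Z: "compact_space Z"
    and g: "\<And>s. s \<in> S \<Longrightarrow> continuous_map (prod_topology Z Z) euclideanreal (\<lambda>(x, y). g s x y)"
    and f: "continuous_map (prod_topology Z Z) euclideanreal (\<lambda>(x, y). f x y)"
    and diag: "\<And>z. z \<in> topspace Z \<Longrightarrow> f z z < \<eta>"
    and sep: "\<And>z z'. z \<in> topspace Z \<Longrightarrow> z' \<in> topspace Z \<Longrightarrow> z \<noteq> z' \<Longrightarrow> \<exists>s\<in>S. 0 < g s z z'"
  obtains F \<tau> where "finite F" "F \<subseteq> S" "0 < \<tau>"
    "\<And>z z'. z \<in> topspace Z \<Longrightarrow> z' \<in> topspace Z \<Longrightarrow> (\<And>s. s \<in> F \<Longrightarrow> g s z z' \<le> \<tau>) \<Longrightarrow> f z z' < \<eta>"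
proof -
  define P where "P = prod_topology Z Z"
  define C where "C = {u \<in> topspace P. (\<lambda>(x, y). f x y) u \<in> {\<eta>..}}"
  \<comment> \<open>Off the diagonal some \<open>g s\<close> is positive, so these open sets cover
    the compact set \<open>C\<close>. Indexing by pairs \<open>(s, n)\<close> makes one finite
    subcover yield both the finite subset of \<open>S\<close> and the threshold.\<close>
  define U where "U j = {u \<in> topspace P. (\<lambda>(x, y). g (fst j) x y) u \<in> {1 / real (Suc (snd j))<..}}"
    for j :: "'s \<times> nat"
  have "compact_space P"
    unfolding P_def using Z by (simp add: compact_space_prod_topology)
  moreover have "closedin P C"
    unfolding C_def by (rule closedin_continuous_map_preimage[OF f[folded P_def]]) simp
  ultimately have C: "compactin P C"
    by (rule closedin_compact_space)
  have openU: "openin P V" if "V \<in> U ` (S \<times> UNIV)" for V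
  proof -
    have "\<exists>j. fst j \<in> S \<and> V = U j" using that by force
    then obtain j where j: "fst j \<in> S" "V = U j" by blast
    show ?thesis
      unfolding j(2) U_def
      by (rule openin_continuous_map_preimage[OF g[OF j(1), folded P_def]]) simp
  qed
  have "C \<subseteq> \<Union> (U ` (S \<times> UNIV))"
  proof
    fix u assume "u \<in> C"
    then obtain z z' where u: "u = (z, z')" "z \<in> topspace Z" "z' \<in> topspace Z" "\<eta> \<le> f z z'"
      unfolding C_def P_def by auto
    then have "z \<noteq> z'" using diag by force
    then obtain s where s: "s \<in> S" "0 < g s z z'" using sep u by blast
    then obtain n where "1 / real (Suc n) < g s z z'"
      using nat_approx_posE by blast
    then have "u \<in> U (s, n)" unfolding U_def P_def using u by simp
    then show "u \<in> \<Union> (U ` (S \<times> UNIV))" using s by blast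
  qed
  then obtain \<V> where \<V>: "finite \<V>" "\<V> \<subseteq> U ` (S \<times> UNIV)" "C \<subseteq> \<Union>\<V>"
    using compactinD[OF C, of "U ` (S \<times> UNIV)"] openU by meson
  then obtain J where J: "finite J" "J \<subseteq> S \<times> UNIV" "\<V> = U ` J"
    by (meson finite_subset_image)
  \<comment> \<open>\<open>insert 0\<close> keeps the maximum meaningful when \<open>C\<close> is
    empty and the subcover has no members.\<close>
  define N where "N = Max (insert 0 (snd ` J))"
  show ?thesis
  proof
    show "finite (fst ` J)" "fst ` J \<subseteq> S" "0 < 1 / real (Suc N)" using J by auto
    fix z z' assume z: "z \<in> topspace Z" "z' \<in> topspace Z"
      and small: "\<And>s. s \<in> fst ` J \<Longrightarrow> g s z z' \<le> 1 / real (Suc N)"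
    show "f z z' < \<eta>"
    proof (rule ccontr)
      assume "\<not> f z z' < \<eta>"
      then have "(z, z') \<in> C" unfolding C_def P_def using z by simp
      then obtain s n where j: "(s, n) \<in> J" "(z, z') \<in> U (s, n)" using \<V> J by auto
      then have "1 / real (Suc n) < g s z z'" unfolding U_def by simp
      moreover have "n \<le> N"
        unfolding N_def using J j by (intro Max_ge) (auto intro: rev_image_eqI)
      then have "1 / real (Suc N) \<le> 1 / real (Suc n)"
        by (intro divide_left_mono) auto
      moreover have "g s z z' \<le> 1 / real (Suc N)" using small j by force
      ultimately show False by simp
    qed
  qed
qed

lemma continuous_map_pair:
  assumes "continuous_map X Y f" "continuous_map X' Y' g"
    and "continuous_map (prod_topology Y Y') Z (\<lambda>(x, y). h x y)"
  shows "continuous_map (prod_topology X X') Z (\<lambda>(x, y). h (f x) (g y))"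
proof -
  have "continuous_map (prod_topology X X') (prod_topology Y Y') (\<lambda>u. (f (fst u), g (snd u)))"
    using continuous_map_compose[OF continuous_map_fst assms(1)]
      continuous_map_compose[OF continuous_map_snd assms(2)]
    by (auto simp: continuous_map_pairwise o_def)
  from continuous_map_compose[OF this assms(3)] show ?thesis
    by (simp add: o_def case_prod_unfold)
qed

lemma continuous_map_slice:
  assumes "continuous_map (prod_topology X Y) Z (\<lambda>(x, y). f x y)" "x \<in> topspace X"
  shows "continuous_map Y Z (f x)"
proof -
  have "continuous_map Y (prod_topology X Y) (\<lambda>y. (x, y))"
    using assms(2) by (intro continuous_map_pairedI) auto
  from continuous_map_compose[OF this assms(1)] show ?thesis by (simp add: o_def)
qed

lemma compact_space_finite_net:
  fixes W :: "'x \<Rightarrow> 'x \<Rightarrow> real"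
  assumes "compact_space X"
    and W: "continuous_map (prod_topology X X) euclideanreal (\<lambda>(x, y). W x y)"
    and diag: "\<And>x. x \<in> topspace X \<Longrightarrow> W x x < \<beta>"
  obtains N where "finite N" "N \<subseteq> topspace X" "\<And>x. x \<in> topspace X \<Longrightarrow> \<exists>z\<in>N. W z x < \<beta>"
proof -
  define U where "U z = {x \<in> topspace X. W z x \<in> {..<\<beta>}}" for z
  have "openin X (U z)" if "z \<in> topspace X" for z
    unfolding U_def
    by (rule openin_continuous_map_preimage[OF continuous_map_slice[OF W that]]) simp
  moreover have "topspace X \<subseteq> \<Union> (U ` topspace X)"
    unfolding U_def using diag by auto
  ultimately obtain \<V> where \<V>: "finite \<V>" "\<V> \<subseteq> U ` topspace X" "topspace X \<subseteq> \<Union>\<V>"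
    using assms(1) unfolding compact_space_alt by (smt (verit) image_iff)
  then obtain N where "finite N" "N \<subseteq> topspace X" "\<V> = U ` N"
    by (meson finite_subset_image)
  then show ?thesis
    using \<V> by (intro that) (auto simp: U_def)
qed

text \<open>Fibres are upper semicontinuous because \<open>p\<close> is closed. Since \<open>p\<close> need not be open, \<open>y\<close>
  cannot be prescribed to be the image of a point of \<open>A\<close>.\<close>

lemma fibre_upper_semicontinuous:
  fixes W :: "'x \<Rightarrow> 'x \<Rightarrow> real"
  assumes "compact_space X" and p: "continuous_map X Y p" "p ` topspace X = M"
    and M: "Metric_space M dM" and Y: "Y = Metric_space.mtopology M dM"
    and W: "continuous_map (prod_topology X X) euclideanreal (\<lambda>(x, y). W x y)"
    and diag: "\<And>x. x \<in> topspace X \<Longrightarrow> W x x < \<beta>"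
  obtains r where "0 < r"
    "\<And>A. A \<subseteq> topspace X \<Longrightarrow> (\<And>x x'. x \<in> A \<Longrightarrow> x' \<in> A \<Longrightarrow> dM (p x) (p x') < r) \<Longrightarrow>
      \<exists>y. \<forall>x\<in>A. \<exists>z\<in>topspace X. p z = y \<and> W z x < \<beta>"
proof -
  interpret Metric_space M dM by (rule M)
  note p = p[unfolded Y]
  have pM: "p x \<in> M" if "x \<in> topspace X" for x using p(2) that by blast
  have comp: "compactin mtopology M"
    using image_compactin[OF _ p(1), of "topspace X"] assms(1) p(2)
    by (simp add: compact_space_def)
  have closed: "closed_map X mtopology p"
    using p(1) assms(1) Hausdorff_space_mtopology by (auto intro: continuous_imp_closed_map)
  define U where "U z = {x \<in> topspace X. W z x \<in> {..<\<beta>}}" for z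
  \<comment> \<open>\<open>O' y\<close> is a neighbourhood of the fibre over \<open>y\<close>, and
    \<open>V y\<close> consists of the base points whose entire fibre lies in it. Closedness of
    \<open>p\<close> makes \<open>V y\<close> open.\<close>
  define O' where "O' y = \<Union> (U ` {z \<in> topspace X. p z = y})" for y
  define V where "V y = M - p ` (topspace X - O' y)" for y
  have "openin X (U z)" if "z \<in> topspace X" for z
    unfolding U_def
    by (rule openin_continuous_map_preimage[OF continuous_map_slice[OF W that]]) simp
  then have "openin X (O' y)" for y unfolding O'_def by auto
  then have "closedin X (topspace X - O' y)" for y by auto
  then have "closedin mtopology (p ` (topspace X - O' y))" for y
    using closed unfolding closed_map_def by blast
  then have openV: "openin mtopology (V y)" for y
    unfolding V_def by (metis openin_diff openin_topspace topspace_mtopology)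
  have inV: "y \<in> V y" if "y \<in> M" for y
    using that diag unfolding V_def O'_def U_def by auto
  \<comment> \<open>With a Lebesgue number of the cover by the \<open>V y\<close>, a set of images
    of diameter below \<open>r\<close> lies in a ball about any of its points, hence in a single
    \<open>V y\<close>. This \<open>y\<close> is the common base point.\<close>
  obtain r where r: "0 < r" "\<And>y. y \<in> M \<Longrightarrow> \<exists>D\<in>V ` M. mball y r \<subseteq> D"
    using lebesgue_number[OF comp, of "V ` M"] openV inV by blast
  show ?thesis
  proof
    show "0 < r" by fact
    fix A assume A: "A \<subseteq> topspace X" "\<And>x x'. x \<in> A \<Longrightarrow> x' \<in> A \<Longrightarrow> dM (p x) (p x') < r"
    show "\<exists>y. \<forall>x\<in>A. \<exists>z\<in>topspace X. p z = y \<and> W z x < \<beta>"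
    proof (cases "A = {}")
      case False
      then obtain x0 where x0: "x0 \<in> A" by blast
      then obtain y where y: "mball (p x0) r \<subseteq> V y" using r A(1) pM by blast
      have "\<exists>z\<in>topspace X. p z = y \<and> W z x < \<beta>" if x: "x \<in> A" for x
      proof -
        have "p x \<in> mball (p x0) r" using A x x0 pM by (simp add: subset_iff)
        then have "p x \<in> V y" using y by blast
        then have "x \<in> O' y" unfolding V_def using A(1) x by blast
        then show ?thesis unfolding O'_def U_def by auto
      qed
      then show ?thesis by blast
    qed simp
  qed
qed

section \<open>Sparse labellings\<close>

text \<open>A Chernoff-type weighting: \<open>None\<close> has weight 1 and every other label weight
  \<open>x\<close>. The total weight of all labellings factors over the coordinates as
  \<open>(1 + card N * x) ^ d\<close>, while each sparse labelling weighs at least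
  \<open>x powr (\<kappa> * d)\<close>.\<close>

lemma card_sparse_labellings:
  fixes x \<kappa> :: real
  assumes "finite N" "0 < x" "x \<le> 1"
  shows "real (card {c \<in> {1..d} \<rightarrow>\<^sub>E insert None (Some ` N).
                      real (card {v \<in> {1..d}. c v \<noteq> None}) \<le> \<kappa> * real d})
         \<le> exp (real d * (\<kappa> * ln (1 / x) + real (card N) * x))"
proof -
  define w where "w l = (if l = None then 1 else x)" for l :: "'a option"
  define L where "L = insert None (Some ` N)"
  define K where "K = {c \<in> {1..d} \<rightarrow>\<^sub>E L. real (card {v \<in> {1..d}. c v \<noteq> None}) \<le> \<kappa> * real d}"
  have finL: "finite L" unfolding L_def using assms by simp
  have finP: "finite ({1..d} \<rightarrow>\<^sub>E L)" using finL by (intro finite_PiE) auto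
  have prodw: "(\<Prod>v\<in>{1..d}. w (c v)) = x ^ card {v \<in> {1..d}. c v \<noteq> None}" for c
  proof -
    have "(\<Prod>v\<in>{1..d}. w (c v)) = (\<Prod>v\<in>{v \<in> {1..d}. c v \<noteq> None}. x)"
      unfolding w_def by (rule prod.mono_neutral_cong_right) auto
    then show ?thesis by simp
  qed
  have "real (card K) * x powr (\<kappa> * d) = (\<Sum>c\<in>K. x powr (\<kappa> * d))" by simp
  also have "\<dots> \<le> (\<Sum>c\<in>K. \<Prod>v\<in>{1..d}. w (c v))"
  proof (rule sum_mono)
    fix c assume "c \<in> K"
    then have "x powr (\<kappa> * d) \<le> x powr (real (card {v \<in> {1..d}. c v \<noteq> None}))"
      unfolding K_def using assms by (intro powr_mono') auto
    then show "x powr (\<kappa> * d) \<le> (\<Prod>v\<in>{1..d}. w (c v))"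
      unfolding prodw using assms by (simp add: powr_realpow)
  qed
  also have "\<dots> \<le> (\<Sum>c\<in>{1..d} \<rightarrow>\<^sub>E L. \<Prod>v\<in>{1..d}. w (c v))"
    unfolding prodw using finP assms by (intro sum_mono2) (auto simp: K_def)
  also have "\<dots> = (\<Prod>v\<in>{1..d}. \<Sum>l\<in>L. w l)"
    using finL by (subst prod_sum_PiE) auto
  also have "(\<Sum>l\<in>L. w l) = 1 + real (card N) * x"
    unfolding L_def w_def using assms by (subst sum.insert) (auto simp: sum.reindex)
  also have "(\<Prod>v\<in>{1..d}. 1 + real (card N) * x) = (1 + real (card N) * x) ^ d" by simp
  also have "\<dots> \<le> exp (real (card N) * x) ^ d"
    using assms by (intro power_mono exp_ge_add_one_self) auto
  also have "\<dots> = exp (real d * (real (card N) * x))" by (simp add: exp_of_nat_mult)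
  finally have "real (card K) * x powr (\<kappa> * d) \<le> exp (real d * (real (card N) * x))" .
  moreover have "x powr (\<kappa> * d) = exp (- (real d * (\<kappa> * ln (1 / x))))"
    using assms by (simp add: powr_def ln_div)
  ultimately have "real (card K) \<le> exp (real d * (real (card N) * x)) * exp (real d * (\<kappa> * ln (1 / x)))"
    by (simp add: exp_minus field_simps)
  then show ?thesis
    unfolding K_def L_def by (simp add: distrib_left exp_add mult.commute)
qed

lemma card_sparse_labellings_subexponential:
  fixes \<gamma> :: real
  assumes "finite N" "0 < \<gamma>"
  obtains \<kappa> where "0 < \<kappa>"
    "\<And>d. real (card {c \<in> {1..d} \<rightarrow>\<^sub>E insert None (Some ` N).
                      real (card {v \<in> {1..d}. c v \<noteq> None}) \<le> \<kappa> * real d}) \<le> exp (real d * \<gamma>)"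
proof -
  \<comment> \<open>The summand 1 keeps the divisor positive for an empty net; the cap 1/2 on
    \<open>x\<close> keeps \<open>ln (1 / x)\<close> positive.\<close>
  define m where "m = real (card N) + 1"
  define x where "x = min (1/2) (\<gamma> / (2 * m))"
  have m: "0 < m" "real (card N) \<le> m" unfolding m_def by auto
  have x: "0 < x" "x \<le> 1/2" "x \<le> \<gamma> / (2 * m)"
    unfolding x_def using assms(2) m by (simp_all only: min.cobounded1 min.cobounded2) simp
  have "real (card N) * x \<le> m * (\<gamma> / (2 * m))"
    using x m by (intro mult_mono) auto
  also have "\<dots> = \<gamma> / 2" using m by simp
  finally have 1: "real (card N) * x \<le> \<gamma> / 2" .
  have lx: "0 < ln (1 / x)" using x by simp
  \<comment> \<open>With \<open>x\<close> fixed, half of \<open>\<gamma>\<close> pays for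
    \<open>card N * x\<close> and this choice spends the other half on
    \<open>\<kappa> * ln (1 / x)\<close>. None of this involves \<open>d\<close>.\<close>
  define \<kappa> where "\<kappa> = \<gamma> / (2 * ln (1 / x))"
  have 2: "\<kappa> * ln (1 / x) = \<gamma> / 2" unfolding \<kappa>_def using lx by simp
  show ?thesis
  proof
    show "0 < \<kappa>" unfolding \<kappa>_def using lx assms by simp
    fix d :: nat
    have "real (card {c \<in> {1..d} \<rightarrow>\<^sub>E insert None (Some ` N).
            real (card {v \<in> {1..d}. c v \<noteq> None}) \<le> \<kappa> * real d})
          \<le> exp (real d * (\<kappa> * ln (1 / x) + real (card N) * x))"
      using x assms by (intro card_sparse_labellings) auto
    also have "\<dots> \<le> exp (real d * \<gamma>)"
      using 1 2 by (auto intro!: mult_left_mono)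
    finally show "real (card {c \<in> {1..d} \<rightarrow>\<^sub>E insert None (Some ` N).
            real (card {v \<in> {1..d}. c v \<noteq> None}) \<le> \<kappa> * real d}) \<le> exp (real d * \<gamma>)" .
  qed
qed

section \<open>Exceptional coordinates: Chebyshev's inequality and asymptotic
  multiplicativity\<close>

lemma card_dist2_large:
  assumes "dist2 \<rho> d \<phi> \<psi> \<le> \<delta>" "0 < \<tau>"
  shows "real (card {v \<in> {1..d}. \<tau> < \<rho> (\<phi> v) (\<psi> v)}) \<le> (\<delta> / \<tau>)\<^sup>2 * real d"
proof (cases "d = 0")
  case False
  define B where "B = {v \<in> {1..d}. \<tau> < \<rho> (\<phi> v) (\<psi> v)}"
  define S where "S = (\<Sum>v\<in>{1..d}. (\<rho> (\<phi> v) (\<psi> v))\<^sup>2)"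
  have "1 / real d * S \<le> \<delta>\<^sup>2"
    using assms(1) unfolding dist2_def S_def[symmetric]
    by (rule sqrt_le_D)
  then have S: "S \<le> \<delta>\<^sup>2 * real d" using False by (simp add: field_simps)
  have "real (card B) * \<tau>\<^sup>2 = (\<Sum>v\<in>B. \<tau>\<^sup>2)" by simp
  also have "\<dots> \<le> (\<Sum>v\<in>B. (\<rho> (\<phi> v) (\<psi> v))\<^sup>2)"
    unfolding B_def using assms(2) by (intro sum_mono power_mono) auto
  also have "\<dots> \<le> S"
    unfolding S_def by (intro sum_mono2) (auto simp: B_def)
  finally have "real (card B) * \<tau>\<^sup>2 \<le> \<delta>\<^sup>2 * real d" using S by simp
  then show ?thesis
    unfolding B_def[symmetric] using assms(2) by (simp add: field_simps power_divide)
qed simp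

lemma card_preimage_permutes:
  assumes "\<pi> permutes A"
  shows "card {v \<in> A. P (\<pi> v)} = card {v \<in> A. P v}"
proof (rule bij_betw_same_card)
  have "v \<in> \<pi> ` {v \<in> A. P (\<pi> v)}" if "v \<in> A" "P v" for v
  proof -
    obtain u where "v = \<pi> u" using permutes_surj[OF assms] by (meson surjD)
    then show ?thesis using that permutes_in_image[OF assms] by auto
  qed
  then have "\<pi> ` {v \<in> A. P (\<pi> v)} = {v \<in> A. P v}"
    using permutes_in_image[OF assms] by auto
  then show "bij_betw \<pi> {v \<in> A. P (\<pi> v)} {v \<in> A. P v}"
    using permutes_inj_on[OF assms] by (simp add: bij_betw_def)
qed

lemma sofic_approximation_permutes:
  assumes "sofic_approximation G d \<sigma>" "s \<in> carrier G"
  shows "\<sigma> i s permutes {1..d i}"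
  using assms unfolding sofic_approximation_def by blast

lemma sofic_approximation_eventually_mult:
  assumes "sofic_approximation G d \<sigma>" "s \<in> carrier G" "t \<in> carrier G" "0 < \<alpha>"
  shows "\<forall>\<^sub>F i in sequentially.
    real (card {v \<in> {1..d i}. \<sigma> i s (\<sigma> i t v) \<noteq> \<sigma> i (s \<otimes>\<^bsub>G\<^esub> t) v}) \<le> \<alpha> * real (d i)"
proof -
  let ?g = "\<lambda>i. {v \<in> {1..d i}. \<sigma> i s (\<sigma> i t v) = \<sigma> i (s \<otimes>\<^bsub>G\<^esub> t) v}"
  have "(\<lambda>i. real (card (?g i)) / real (d i)) \<longlonglongrightarrow> 1"
    using assms unfolding sofic_approximation_def by blast
  then have "\<forall>\<^sub>F i in sequentially. 1 - \<alpha> < real (card (?g i)) / real (d i)"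
    using assms(4) by (intro order_tendstoD) auto
  then show ?thesis
  proof eventually_elim
    case (elim i)
    show ?case
    proof (cases "d i = 0")
      case False
      have eq: "{v \<in> {1..d i}. \<sigma> i s (\<sigma> i t v) \<noteq> \<sigma> i (s \<otimes>\<^bsub>G\<^esub> t) v} = {1..d i} - ?g i" by auto
      have "card ({1..d i} - ?g i) = d i - card (?g i)"
        by (subst card_Diff_subset) auto
      moreover have "card (?g i) \<le> d i"
        using card_mono[of "{1..d i}" "?g i"] by (simp add: subset_eq)
      ultimately show ?thesis
        unfolding eq using elim False by (simp add: of_nat_diff field_simps)
    qed simp
  qed
qed

section \<open>Defects of approximately equivariant maps\<close>

lemma sofic_Map_mono:
  assumes "F \<subseteq> F'" "\<delta>' \<le> \<delta>"
  shows "sofic_Map X a \<rho> F' \<delta>' d \<sigma> \<subseteq> sofic_Map X a \<rho> F \<delta> d \<sigma>"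
  using assms unfolding sofic_Map_def by force

lemma dynamical_system_continuous:
  assumes "dynamical_system G X a" "s \<in> carrier G"
  shows "continuous_map X X (a s)"
proof (rule continuous_map_slice)
  show "continuous_map (prod_topology (discrete_topology (carrier G)) X) X (\<lambda>(s, x). a s x)"
    using assms(1) unfolding dynamical_system_def by (elim conjE)
  show "s \<in> topspace (discrete_topology (carrier G))" using assms(2) by simp
qed

lemma dynamical_system_closed:
  assumes "dynamical_system G X a" "s \<in> carrier G" "x \<in> topspace X"
  shows "a s x \<in> topspace X"
  using continuous_map_funspace[OF dynamical_system_continuous[OF assms(1,2)]] assms(3) by blast

lemma dynamically_generatingD:
  assumes "dynamically_generating G X a \<rho>" "x \<in> topspace X" "x' \<in> topspace X" "x \<noteq> x'"
  shows "\<exists>s\<in>carrier G. 0 < \<rho> (a s x) (a s x')"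
  using assms unfolding dynamically_generating_def by (auto simp: less_SUP_iff)

lemma continuous_pseudometric_continuous:
  assumes "continuous_pseudometric X \<rho>"
  shows "continuous_map (prod_topology X X) euclideanreal (\<lambda>(x, y). \<rho> x y)"
  using assms unfolding continuous_pseudometric_def by blast

lemma continuous_pseudometricD:
  assumes "continuous_pseudometric X \<rho>" "x \<in> topspace X" "y \<in> topspace X"
  shows "0 \<le> \<rho> x y" "\<rho> x y = \<rho> y x" "\<rho> x x = 0"
    "z \<in> topspace X \<Longrightarrow> \<rho> x z \<le> \<rho> x y + \<rho> y z"
  using assms unfolding continuous_pseudometric_def by blast+

text \<open>Compactness replaces the supremum over the whole group by finitely many translates and a
  threshold. On \<open>X\<close> this bounds defects measured by a function other than
  \<open>\<rho>\<close>; on \<open>Y\<close> it bounds a metric inducing the topology.\<close>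

lemma dynamically_generating_control:
  assumes X: "dynamical_system G X a"
    and \<rho>: "continuous_pseudometric X \<rho>" "dynamically_generating G X a \<rho>"
    and f: "continuous_map (prod_topology X X) euclideanreal (\<lambda>(x, y). f x y)"
    and diag: "\<And>x. x \<in> topspace X \<Longrightarrow> f x x < \<eta>"
  obtains F \<tau> where "finite F" "F \<subseteq> carrier G" "0 < \<tau>"
    "\<And>x x'. x \<in> topspace X \<Longrightarrow> x' \<in> topspace X \<Longrightarrow>
       (\<And>s. s \<in> F \<Longrightarrow> \<rho> (a s x) (a s x') \<le> \<tau>) \<Longrightarrow> f x x' < \<eta>"
proof -
  have comp: "compact_space X" using X unfolding dynamical_system_def by blast
  have cont: "continuous_map (prod_topology X X) euclideanreal (\<lambda>(x, y). \<rho> (a s x) (a s y))"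
    if "s \<in> carrier G" for s
    using dynamical_system_continuous[OF X that] dynamical_system_continuous[OF X that]
      continuous_pseudometric_continuous[OF \<rho>(1)]
    by (rule continuous_map_pair)
  show ?thesis
    by (rule compact_family_control[where g = "\<lambda>s x x'. \<rho> (a s x) (a s x')",
          OF comp cont f diag dynamically_generatingD[OF \<rho>(2)]])
      (use that in blast)+
qed

text \<open>Smallness of \<open>f\<close> is controlled by finitely many translates of \<open>\<rho>\<close>, and the translate by \<open>t\<close>
  of the defect of \<open>\<phi>\<close> at \<open>s\<close> is bounded by its defects at \<open>t \<otimes> s\<close> and at \<open>t\<close>.\<close>

lemma sofic_Map_few_defects:
  fixes G (structure)
  assumes G: "group G" and sof: "sofic_approximation G d \<sigma>" and X: "dynamical_system G X a"
    and \<rho>: "continuous_pseudometric X \<rho>" "dynamically_generating G X a \<rho>"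
    and f: "continuous_map (prod_topology X X) euclideanreal (\<lambda>(x, y). f x y)"
    and diag: "\<And>x. x \<in> topspace X \<Longrightarrow> f x x < \<tau>"
    and S: "finite S" "S \<subseteq> carrier G" and \<kappa>: "0 < \<kappa>"
  obtains F \<delta> where "finite F" "F \<subseteq> carrier G" "0 < \<delta>"
    "\<forall>\<^sub>F i in sequentially. \<forall>\<phi>\<in>sofic_Map X a \<rho> F \<delta> (d i) (\<sigma> i).
       real (card {v \<in> {1..d i}. \<exists>s\<in>S. \<tau> \<le> f (a s (\<phi> v)) (\<phi> (\<sigma> i s v))}) \<le> \<kappa> * real (d i)"
proof -
  interpret group G by (rule G)
  obtain T \<eta> where T: "finite T" "T \<subseteq> carrier G" and \<eta>: "0 < \<eta>"
    and control: "\<And>x x'. x \<in> topspace X \<Longrightarrow> x' \<in> topspace X \<Longrightarrow>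
       (\<And>t. t \<in> T \<Longrightarrow> \<rho> (a t x) (a t x') \<le> \<eta>) \<Longrightarrow> f x x' < \<tau>"
    by (rule dynamically_generating_control[OF X \<rho> f diag]) (assumption, blast)
  \<comment> \<open>The products enter because translating a defect at \<open>s\<close> by
    \<open>t\<close> requires equivariance at \<open>t \<otimes> s\<close> as well as at
    \<open>t\<close>.\<close>
  define F where "F = T \<union> (\<lambda>(t, s). t \<otimes> s) ` (T \<times> S)"
  define n where "n = real (card S * card T) + 1"
  \<comment> \<open>Each pair in \<open>S \<times> T\<close> contributes three exceptional sets of
    density \<open>\<alpha>\<close>, so the total is at most \<open>\<kappa>\<close>. The value of
    \<open>\<delta>\<close> makes Chebyshev's inequality at level \<open>\<eta> / 2\<close> give
    exactly \<open>\<alpha>\<close>.\<close>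
  define \<alpha> where "\<alpha> = \<kappa> / (3 * n)"
  define \<delta> where "\<delta> = \<eta> / 2 * sqrt \<alpha>"
  have n: "0 < n" unfolding n_def by linarith
  have \<alpha>: "0 < \<alpha>" unfolding \<alpha>_def using \<kappa> n by simp
  have \<delta>: "0 < \<delta>" "(\<delta> / (\<eta> / 2))\<^sup>2 = \<alpha>" unfolding \<delta>_def using \<alpha> \<eta> by auto
  have ev: "\<forall>\<^sub>F i in sequentially. \<forall>t\<in>T. \<forall>s\<in>S.
      real (card {v \<in> {1..d i}. \<sigma> i t (\<sigma> i s v) \<noteq> \<sigma> i (t \<otimes> s) v}) \<le> \<alpha> * real (d i)"
    using S T \<alpha> by (intro eventually_ball_finite ballI sofic_approximation_eventually_mult[OF sof]) auto
  show ?thesis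
  proof
    show "finite F" "F \<subseteq> carrier G" unfolding F_def using S T by auto
    show "0 < \<delta>" by fact
    show "\<forall>\<^sub>F i in sequentially. \<forall>\<phi>\<in>sofic_Map X a \<rho> F \<delta> (d i) (\<sigma> i).
       real (card {v \<in> {1..d i}. \<exists>s\<in>S. \<tau> \<le> f (a s (\<phi> v)) (\<phi> (\<sigma> i s v))}) \<le> \<kappa> * real (d i)"
      using ev
    proof eventually_elim
      case (elim i)
      show ?case
      proof
        fix \<phi> assume \<phi>: "\<phi> \<in> sofic_Map X a \<rho> F \<delta> (d i) (\<sigma> i)"
        have \<phi>X: "\<phi> v \<in> topspace X" if "v \<in> {1..d i}" for v
          using \<phi> that unfolding sofic_Map_def by blast
        have \<phi>F: "real (card {v \<in> {1..d i}. \<eta> / 2 < \<rho> (a s (\<phi> v)) (\<phi> (\<sigma> i s v))}) \<le> \<alpha> * real (d i)"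
          if "s \<in> F" for s
        proof -
          have "dist2 \<rho> (d i) (\<lambda>v. a s (\<phi> v)) (\<phi> \<circ> \<sigma> i s) \<le> \<delta>"
            using \<phi> that unfolding sofic_Map_def by blast
          from card_dist2_large[OF this, of "\<eta> / 2"] show ?thesis using \<eta> \<delta>(2) by simp
        qed
        define B where "B u = {v \<in> {1..d i}.
            \<eta> < \<rho> (a (snd u) (a (fst u) (\<phi> v))) (a (snd u) (\<phi> (\<sigma> i (fst u) v)))}" for u
        have B: "real (card (B (s, t))) \<le> 3 * \<alpha> * real (d i)" if st: "s \<in> S" "t \<in> T" for s t
        proof -
          have G[simp]: "s \<in> carrier G" "t \<in> carrier G" using st S T by auto
          have F: "t \<in> F" "t \<otimes> s \<in> F" unfolding F_def using st by auto
          \<comment> \<open>The points \<open>a t (a s (\<phi> v))\<close> and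
            \<open>a t (\<phi> (\<sigma> i s v))\<close> are compared through
            \<open>\<phi> (\<sigma> i t (\<sigma> i s v))\<close>. A distance above
            \<open>\<eta>\<close> requires a failure of multiplicativity or one leg longer than
            \<open>\<eta> / 2\<close>.\<close>
          define B1 where "B1 = {v \<in> {1..d i}. \<eta> / 2 < \<rho> (a (t \<otimes> s) (\<phi> v)) (\<phi> (\<sigma> i (t \<otimes> s) v))}"
          define B2 where "B2 = {v \<in> {1..d i}. \<sigma> i t (\<sigma> i s v) \<noteq> \<sigma> i (t \<otimes> s) v}"
          define B3 where "B3 = {v \<in> {1..d i}. \<eta> / 2 < \<rho> (a t (\<phi> (\<sigma> i s v))) (\<phi> (\<sigma> i t (\<sigma> i s v)))}"
          have per: "\<sigma> i u permutes {1..d i}" if "u \<in> carrier G" for u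
            using sofic_approximation_permutes[OF sof that] .
          \<comment> \<open>\<open>B3\<close> is the exceptional set of \<open>\<phi>\<close> at
            \<open>t\<close> pulled back by the permutation \<open>\<sigma> i s\<close>, so it has
            the same size.\<close>
          have "card B3 = card {v \<in> {1..d i}. \<eta> / 2 < \<rho> (a t (\<phi> v)) (\<phi> (\<sigma> i t v))}"
            unfolding B3_def by (rule card_preimage_permutes[OF per]) auto
          then have 3: "real (card B3) \<le> \<alpha> * real (d i)" using \<phi>F[OF F(1)] by simp
          have 1: "real (card B1) \<le> \<alpha> * real (d i)" unfolding B1_def by (rule \<phi>F[OF F(2)])
          have 2: "real (card B2) \<le> \<alpha> * real (d i)" unfolding B2_def using elim st by blast
          have "B (s, t) \<subseteq> B1 \<union> B2 \<union> B3"
          proof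
            fix v assume "v \<in> B (s, t)"
            then have v: "v \<in> {1..d i}" and big: "\<eta> < \<rho> (a t (a s (\<phi> v))) (a t (\<phi> (\<sigma> i s v)))"
              unfolding B_def by auto
            have sv: "\<sigma> i u v' \<in> {1..d i}" if "u \<in> carrier G" "v' \<in> {1..d i}" for u v'
              using permutes_in_image[OF per[OF that(1)]] that(2) by blast
            have act: "a (t \<otimes> s) (\<phi> v) = a t (a s (\<phi> v))"
              using X \<phi>X[OF v] unfolding dynamical_system_def by auto
            note cl = dynamical_system_closed[OF X]
            have mem: "a t (a s (\<phi> v)) \<in> topspace X" "a t (\<phi> (\<sigma> i s v)) \<in> topspace X"
              "\<phi> (\<sigma> i t (\<sigma> i s v)) \<in> topspace X"
              by (intro cl \<phi>X sv G v)+
            show "v \<in> B1 \<union> B2 \<union> B3"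
            proof (rule ccontr)
              assume "v \<notin> B1 \<union> B2 \<union> B3"
              then have "\<sigma> i t (\<sigma> i s v) = \<sigma> i (t \<otimes> s) v"
                "\<rho> (a t (a s (\<phi> v))) (\<phi> (\<sigma> i (t \<otimes> s) v)) \<le> \<eta> / 2"
                "\<rho> (a t (\<phi> (\<sigma> i s v))) (\<phi> (\<sigma> i t (\<sigma> i s v))) \<le> \<eta> / 2"
                using v unfolding B1_def B2_def B3_def act[symmetric] by auto
              moreover have "\<rho> (a t (a s (\<phi> v))) (a t (\<phi> (\<sigma> i s v)))
                \<le> \<rho> (a t (a s (\<phi> v))) (\<phi> (\<sigma> i t (\<sigma> i s v)))
                  + \<rho> (\<phi> (\<sigma> i t (\<sigma> i s v))) (a t (\<phi> (\<sigma> i s v)))"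
                using continuous_pseudometricD(4)[OF \<rho>(1)] mem by blast
              moreover have "\<rho> (\<phi> (\<sigma> i t (\<sigma> i s v))) (a t (\<phi> (\<sigma> i s v)))
                  = \<rho> (a t (\<phi> (\<sigma> i s v))) (\<phi> (\<sigma> i t (\<sigma> i s v)))"
                using continuous_pseudometricD(2)[OF \<rho>(1)] mem by blast
              ultimately show False using big by simp
            qed
          qed
          then have "card (B (s, t)) \<le> card (B1 \<union> B2 \<union> B3)"
            by (intro card_mono) (auto simp: B1_def B2_def B3_def)
          also have "\<dots> \<le> card B1 + card B2 + card B3"
            by (meson card_Un_le add_le_mono1 order_trans)
          finally have "real (card (B (s, t))) \<le> real (card B1) + real (card B2) + real (card B3)"
            by linarith
          then show ?thesis using 1 2 3 by simp
        qed
        have "{v \<in> {1..d i}. \<exists>s\<in>S. \<tau> \<le> f (a s (\<phi> v)) (\<phi> (\<sigma> i s v))} \<subseteq> (\<Union>u\<in>S \<times> T. B u)"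
        proof
          fix v assume "v \<in> {v \<in> {1..d i}. \<exists>s\<in>S. \<tau> \<le> f (a s (\<phi> v)) (\<phi> (\<sigma> i s v))}"
          then obtain s where v: "v \<in> {1..d i}" and s: "s \<in> S" "\<not> f (a s (\<phi> v)) (\<phi> (\<sigma> i s v)) < \<tau>"
            by auto
          have "s \<in> carrier G" using s S by auto
          then have "a s (\<phi> v) \<in> topspace X"
            using dynamical_system_closed[OF X] \<phi>X v by blast
          have "\<sigma> i s v \<in> {1..d i}"
            using v permutes_in_image[OF sofic_approximation_permutes[OF sof \<open>s \<in> carrier G\<close>]] by blast
          then have "\<phi> (\<sigma> i s v) \<in> topspace X" by (rule \<phi>X)
          then obtain t where "t \<in> T" "\<not> \<rho> (a t (a s (\<phi> v))) (a t (\<phi> (\<sigma> i s v))) \<le> \<eta>"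
            using control s(2) \<open>a s (\<phi> v) \<in> topspace X\<close> by blast
          then show "v \<in> (\<Union>u\<in>S \<times> T. B u)"
            using v s by (intro UN_I[of "(s, t)"]) (auto simp: B_def)
        qed
        then have "card {v \<in> {1..d i}. \<exists>s\<in>S. \<tau> \<le> f (a s (\<phi> v)) (\<phi> (\<sigma> i s v))}
            \<le> card (\<Union>u\<in>S \<times> T. B u)"
          using S T by (intro card_mono) (auto simp: B_def)
        also have "\<dots> \<le> (\<Sum>u\<in>S \<times> T. card (B u))"
          using S T by (intro card_UN_le) auto
        finally have "real (card {v \<in> {1..d i}. \<exists>s\<in>S. \<tau> \<le> f (a s (\<phi> v)) (\<phi> (\<sigma> i s v))})
            \<le> real (\<Sum>u\<in>S \<times> T. card (B u))"
          by (rule of_nat_mono)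
        also have "\<dots> = (\<Sum>u\<in>S \<times> T. real (card (B u)))" by (rule of_nat_sum)
        also have "\<dots> \<le> (\<Sum>u\<in>S \<times> T. 3 * \<alpha> * real (d i))"
          using B by (intro sum_mono) auto
        also have "\<dots> = real (card S * card T) * (3 * \<alpha> * real (d i))"
          by (simp add: card_cartesian_product)
        also have "\<dots> \<le> n * (3 * \<alpha> * real (d i))"
          unfolding n_def using \<alpha> by (intro mult_right_mono) auto
        also have "\<dots> = \<kappa> * real (d i)"
          unfolding \<alpha>_def using n by simp
        finally show "real (card {v \<in> {1..d i}. \<exists>s\<in>S. \<tau> \<le> f (a s (\<phi> v)) (\<phi> (\<sigma> i s v))})
            \<le> \<kappa> * real (d i)" .
      qed
    qed
  qed
qed

lemma distinf_ge: "v \<in> {1..d} \<Longrightarrow> \<rho> (\<phi> v) (\<psi> v) \<le> distinf \<rho> d \<phi> \<psi>"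
  unfolding distinf_def by (intro Max_ge) auto

lemma distinf_attained:
  assumes "0 < d"
  obtains v where "v \<in> {1..d}" "distinf \<rho> d \<phi> \<psi> = \<rho> (\<phi> v) (\<psi> v)"
proof -
  have "distinf \<rho> d \<phi> \<psi> \<in> (\<lambda>v. \<rho> (\<phi> v) (\<psi> v)) ` {1..d}"
    unfolding distinf_def using assms by (intro Max_in) auto
  then show ?thesis using that by blast
qed

section \<open>Moving maps into a fibre\<close>

text \<open>At each coordinate all maps of \<open>C\<close> move to points over one common
  \<open>y\<close>, by less than \<open>\<beta>\<close>. Both ends of a distance move, so separation
  drops by at most \<open>2 * \<beta> \<le> \<epsilon> / 2\<close>. Closeness of the translates by
  \<open>F\<close> likewise bounds the growth of each pointwise defect by
  \<open>2 * \<beta> \<le> \<delta> / 2\<close>, which is why the maps start with tolerance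
  \<open>\<delta> / 2\<close>.\<close>

lemma sep_fibre_ge_card_of_near_fibre:
  assumes X: "dynamical_system G X a" and \<rho>: "continuous_pseudometric X \<rho>"
    and F: "F \<subseteq> carrier G" and \<sigma>: "\<And>s. s \<in> F \<Longrightarrow> \<sigma> s permutes {1..d}" and d: "0 < d"
    and pos: "0 < \<epsilon>" "0 < \<delta>" and \<beta>: "\<beta> \<le> \<epsilon> / 4" "\<beta> \<le> \<delta> / 4"
    and C: "finite C" "C \<subseteq> sofic_Map X a \<rho> F (\<delta> / 2) d \<sigma>"
    and sep: "\<And>\<phi> \<phi>'. \<phi> \<in> C \<Longrightarrow> \<phi>' \<in> C \<Longrightarrow> \<phi> \<noteq> \<phi>' \<Longrightarrow> \<epsilon> \<le> distinf \<rho> d \<phi> \<phi>'"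
    and fibre: "\<And>v. v \<in> {1..d} \<Longrightarrow> \<exists>y. \<forall>\<phi>\<in>C. \<exists>z\<in>topspace X. p z = y \<and>
      \<rho> z (\<phi> v) < \<beta> \<and> (\<forall>s\<in>F. \<rho> (a s z) (a s (\<phi> v)) < \<beta>)"
  shows "enat (card C) \<le> sep_fibre \<rho> p d (\<epsilon> / 2) (sofic_Map X a \<rho> F \<delta> d \<sigma>)"
proof -
  have \<phi>X: "\<phi> v \<in> topspace X" if "\<phi> \<in> C" "v \<in> {1..d}" for \<phi> v
    using C(2) that unfolding sofic_Map_def by blast
  obtain y where "\<And>v. v \<in> {1..d} \<Longrightarrow> \<forall>\<phi>\<in>C. \<exists>z\<in>topspace X. p z = y v \<and>
      \<rho> z (\<phi> v) < \<beta> \<and> (\<forall>s\<in>F. \<rho> (a s z) (a s (\<phi> v)) < \<beta>)"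
    using fibre by metis
  then have "\<forall>\<phi> v. \<exists>z. \<phi> \<in> C \<longrightarrow> v \<in> {1..d} \<longrightarrow> z \<in> topspace X \<and> p z = y v \<and>
      \<rho> z (\<phi> v) < \<beta> \<and> (\<forall>s\<in>F. \<rho> (a s z) (a s (\<phi> v)) < \<beta>)"
    by blast
  then obtain z where z: "\<And>\<phi> v. \<phi> \<in> C \<Longrightarrow> v \<in> {1..d} \<Longrightarrow> z \<phi> v \<in> topspace X \<and> p (z \<phi> v) = y v \<and>
      \<rho> (z \<phi> v) (\<phi> v) < \<beta> \<and> (\<forall>s\<in>F. \<rho> (a s (z \<phi> v)) (a s (\<phi> v)) < \<beta>)"
    by metis
  note zX = z[THEN conjunct1]
  define h where "h \<phi> = restrict (z \<phi>) {1..d}" for \<phi>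
  have h: "h \<phi> v = z \<phi> v" if "v \<in> {1..d}" for \<phi> v
    unfolding h_def using that by simp
  note tri = continuous_pseudometricD(4)[OF \<rho>]
  note sym = continuous_pseudometricD(2)[OF \<rho>]
  note cl = dynamical_system_closed[OF X]
  have hMap: "h \<phi> \<in> sofic_Map X a \<rho> F \<delta> d \<sigma>" if \<phi>: "\<phi> \<in> C" for \<phi>
  proof -
    have "dist2 \<rho> d (\<lambda>v. a s (h \<phi> v)) (h \<phi> \<circ> \<sigma> s) \<le> \<delta>" if s: "s \<in> F" for s
    proof -
      define r where "r v = \<rho> (a s (\<phi> v)) (\<phi> (\<sigma> s v))" for v
      have "s \<in> carrier G" using s F by blast
      have "dist2 \<rho> d (\<lambda>v. a s (\<phi> v)) (\<phi> \<circ> \<sigma> s) \<le> \<delta> / 2"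
        using C(2) \<phi> s unfolding sofic_Map_def by blast
      then have "1 / real d * (\<Sum>v\<in>{1..d}. (r v)\<^sup>2) \<le> (\<delta> / 2)\<^sup>2"
        unfolding dist2_def r_def comp_def by (rule sqrt_le_D)
      then have r: "(\<Sum>v\<in>{1..d}. (r v)\<^sup>2) \<le> real d * (\<delta> / 2)\<^sup>2"
        using d by (simp add: field_simps)
      \<comment> \<open>The inequality \<open>(r + c)^2 \<le> 2 * r^2 + 2 * c^2\<close> serves in
        place of Minkowski's: with both halves equal to \<open>\<delta> / 2\<close>, averaging gives
        \<open>\<delta>^2\<close> without loss.\<close>
      have pointwise: "(\<rho> (a s (h \<phi> v)) (h \<phi> (\<sigma> s v)))\<^sup>2 \<le> 2 * (r v)\<^sup>2 + 2 * (\<delta> / 2)\<^sup>2"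
        if v: "v \<in> {1..d}" for v
      proof -
        have sv: "\<sigma> s v \<in> {1..d}" using permutes_in_image[OF \<sigma>[OF s]] v by blast
        note mem = zX[OF \<phi> v] zX[OF \<phi> sv] \<phi>X[OF \<phi> v] \<phi>X[OF \<phi> sv]
        note amem = cl[OF \<open>s \<in> carrier G\<close> mem(1)] cl[OF \<open>s \<in> carrier G\<close> mem(3)]
        have "\<rho> (a s (z \<phi> v)) (z \<phi> (\<sigma> s v))
            \<le> \<rho> (a s (z \<phi> v)) (a s (\<phi> v)) + \<rho> (a s (\<phi> v)) (z \<phi> (\<sigma> s v))"
          by (rule tri[OF amem mem(2)])
        moreover have "\<rho> (a s (\<phi> v)) (z \<phi> (\<sigma> s v)) \<le> r v + \<rho> (\<phi> (\<sigma> s v)) (z \<phi> (\<sigma> s v))"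
          unfolding r_def by (rule tri[OF amem(2) mem(4) mem(2)])
        moreover have "\<rho> (a s (z \<phi> v)) (a s (\<phi> v)) < \<beta>" using z[OF \<phi> v] s by blast
        moreover have "\<rho> (\<phi> (\<sigma> s v)) (z \<phi> (\<sigma> s v)) < \<beta>"
          using z[OF \<phi> sv] sym[OF mem(2) mem(4)] by simp
        ultimately have le: "\<rho> (a s (h \<phi> v)) (h \<phi> (\<sigma> s v)) \<le> r v + \<delta> / 2"
          using \<beta>(2) h[OF v] h[OF sv] by simp
        have "0 \<le> \<rho> (a s (h \<phi> v)) (h \<phi> (\<sigma> s v))"
          unfolding h[OF v] h[OF sv] by (rule continuous_pseudometricD(1)[OF \<rho> amem(1) mem(2)])
        then have "(\<rho> (a s (h \<phi> v)) (h \<phi> (\<sigma> s v)))\<^sup>2 \<le> (r v + \<delta> / 2)\<^sup>2"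
          using le by (intro power_mono)
        also have "\<dots> \<le> 2 * (r v)\<^sup>2 + 2 * (\<delta> / 2)\<^sup>2"
          using zero_le_power2[of "r v - \<delta> / 2"] by (simp only: power2_sum power2_diff)
        finally show ?thesis .
      qed
      have "(\<Sum>v\<in>{1..d}. (\<rho> (a s (h \<phi> v)) (h \<phi> (\<sigma> s v)))\<^sup>2)
          \<le> (\<Sum>v\<in>{1..d}. 2 * (r v)\<^sup>2 + 2 * (\<delta> / 2)\<^sup>2)"
        by (rule sum_mono) (rule pointwise)
      also have "\<dots> = 2 * (\<Sum>v\<in>{1..d}. (r v)\<^sup>2) + real d * (2 * (\<delta> / 2)\<^sup>2)"
        by (simp add: sum.distrib sum_distrib_left)
      also have "\<dots> \<le> real d * \<delta>\<^sup>2"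
        using r by (simp add: power_divide)
      finally have "1 / real d * (\<Sum>v\<in>{1..d}. (\<rho> (a s (h \<phi> v)) (h \<phi> (\<sigma> s v)))\<^sup>2) \<le> \<delta>\<^sup>2"
        using d by (simp add: field_simps)
      then show ?thesis
        unfolding dist2_def comp_def using pos(2) by (intro real_le_lsqrt) auto
    qed
    moreover have "h \<phi> \<in> {1..d} \<rightarrow>\<^sub>E topspace X"
      unfolding h_def using zX[OF \<phi>] by (intro PiE_I) auto
    ultimately show ?thesis unfolding sofic_Map_def by blast
  qed
  \<comment> \<open>Naming a coordinate instead of bounding the maximum lets the same fact also give
    injectivity of \<open>h\<close>, as a pseudometric vanishes on equal points.\<close>
  have far: "\<exists>v\<in>{1..d}. \<epsilon> / 2 \<le> \<rho> (h \<phi> v) (h \<phi>' v)" if \<phi>: "\<phi> \<in> C" "\<phi>' \<in> C" "\<phi> \<noteq> \<phi>'" for \<phi> \<phi>'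
  proof -
    obtain v where v: "v \<in> {1..d}" "distinf \<rho> d \<phi> \<phi>' = \<rho> (\<phi> v) (\<phi>' v)"
      using distinf_attained[OF d] by blast
    note mem = zX[OF \<phi>(1) v(1)] zX[OF \<phi>(2) v(1)] \<phi>X[OF \<phi>(1) v(1)] \<phi>X[OF \<phi>(2) v(1)]
    have "\<epsilon> \<le> \<rho> (\<phi> v) (\<phi>' v)" using sep[OF \<phi>] v(2) by simp
    also have "\<dots> \<le> \<rho> (\<phi> v) (z \<phi> v) + \<rho> (z \<phi> v) (\<phi>' v)"
      by (rule tri[OF mem(3) mem(1) mem(4)])
    also have "\<rho> (z \<phi> v) (\<phi>' v) \<le> \<rho> (z \<phi> v) (z \<phi>' v) + \<rho> (z \<phi>' v) (\<phi>' v)"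
      by (rule tri[OF mem(1) mem(2) mem(4)])
    finally have "\<epsilon> / 2 \<le> \<rho> (z \<phi> v) (z \<phi>' v)"
      using z[OF \<phi>(1) v(1)] z[OF \<phi>(2) v(1)] sym[OF mem(1) mem(3)] \<beta>(1) by simp
    then show ?thesis using v(1) h by metis
  qed
  have "inj_on h C"
  proof (rule inj_onI, rule ccontr)
    fix \<phi> \<phi>' assume \<phi>: "\<phi> \<in> C" "\<phi>' \<in> C" and eq: "h \<phi> = h \<phi>'" and "\<phi> \<noteq> \<phi>'"
    then obtain v where "v \<in> {1..d}" "\<epsilon> / 2 \<le> \<rho> (h \<phi>' v) (h \<phi>' v)" using far by metis
    then show False
      using continuous_pseudometricD(3)[OF \<rho> zX[OF \<phi>(2)] zX[OF \<phi>(2)], of v] h pos(1) by simp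
  qed
  then have card: "card (h ` C) = card C" by (rule card_image)
  have "compose {1..d} p (h \<phi>) = compose {1..d} p (h \<phi>')" if "\<phi> \<in> C" "\<phi>' \<in> C" for \<phi> \<phi>'
    unfolding compose_def using z that h by (intro restrict_ext) metis
  moreover have "\<epsilon> / 2 \<le> distinf \<rho> d (h \<phi>) (h \<phi>')"
    if \<phi>: "\<phi> \<in> C" "\<phi>' \<in> C" "h \<phi> \<noteq> h \<phi>'" for \<phi> \<phi>'
  proof -
    have "\<phi> \<noteq> \<phi>'" using \<phi> by blast
    then obtain v where "v \<in> {1..d}" "\<epsilon> / 2 \<le> \<rho> (h \<phi> v) (h \<phi>' v)" using far[OF \<phi>(1,2)] by blast
    then show ?thesis using distinf_ge[of v d \<rho> "h \<phi>" "h \<phi>'"] by linarith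
  qed
  ultimately have "\<forall>\<psi>\<in>h ` C. \<forall>\<psi>'\<in>h ` C. \<psi> \<noteq> \<psi>' \<longrightarrow>
      compose {1..d} p \<psi> = compose {1..d} p \<psi>' \<and> \<epsilon> / 2 \<le> distinf \<rho> d \<psi> \<psi>'"
    by blast
  moreover have "finite (h ` C)" "h ` C \<subseteq> sofic_Map X a \<rho> F \<delta> d \<sigma>"
    using C(1) hMap by blast+
  ultimately show ?thesis
    unfolding sep_fibre_def card[symmetric] by (intro SUP_upper CollectI conjI)
qed

section \<open>Normalised logarithms of counts\<close>

lemma elog_mono: "m \<le> n \<Longrightarrow> elog m \<le> elog n"
  unfolding elog_def by (cases m; cases n) auto

lemma elog_cases: "elog n = -\<infinity> \<or> 0 \<le> elog n"
  unfolding elog_def by (cases n) auto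

text \<open>After taking logarithms and dividing by \<open>d\<close>, a factor of size at most
  \<open>exp (d * \<gamma>)\<close> becomes the additive cost \<open>\<gamma>\<close>. If
  \<open>q\<close> is infinite then so is the right-hand side, because \<open>d\<close> is
  positive.\<close>

lemma elog_mult_le:
  assumes "m \<le> of_nat R * q" "real R \<le> exp (real d * \<gamma>)" "0 < d"
  shows "ereal (1 / real d) * elog m \<le> ereal \<gamma> + ereal (1 / real d) * elog q"
proof (cases q)
  case infinity
  then show ?thesis using assms(3) by (simp add: elog_def)
next
  case (enat k)
  then have "m \<le> enat (R * k)" using assms(1) by (simp add: of_nat_eq_enat)
  then obtain n where n: "m = enat n" "n \<le> R * k" by (cases m) auto
  show ?thesis
  proof (cases "n = 0")
    case True
    then show ?thesis using n assms(3) by (simp add: elog_def zero_enat_def)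
  next
    case False
    then have k: "0 < k" "0 < R" using n(2) by (auto intro: gr0I)
    have "ln (real n) \<le> ln (real R * real k)"
      using False n(2) k by (subst ln_le_cancel_iff) (auto simp flip: of_nat_mult)
    also have "\<dots> = ln (real R) + ln (real k)" using k by (simp add: ln_mult)
    also have "ln (real R) \<le> real d * \<gamma>"
      using assms(2) k by (metis ln_exp ln_le_cancel_iff exp_gt_zero of_nat_0_less_iff)
    finally have "1 / real d * ln (real n) \<le> \<gamma> + 1 / real d * ln (real k)"
      using assms(3) by (simp add: field_simps)
    then show ?thesis
      unfolding n(1) enat elog_def using False k by simp
  qed
qed

lemma continuous_map_add_pair:
  fixes f g :: "'x \<Rightarrow> 'x \<Rightarrow> real"
  assumes "continuous_map P euclideanreal (\<lambda>(x, y). f x y)"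
    and "continuous_map P euclideanreal (\<lambda>(x, y). g x y)"
  shows "continuous_map P euclideanreal (\<lambda>(x, y). f x y + g x y)"
  using continuous_map_add[OF assms] by (simp add: case_prod_unfold)

text \<open>A set of pairwise \<open>\<theta>\<close>-near maps is partitioned according to labellings: \<open>v\<close> carries the
  label \<open>None\<close> if \<open>\<phi>\<close> is nearly equivariant at \<open>v\<close>, and otherwise a point of a finite net near
  \<open>\<phi> v\<close>. As the maps have few defects, there are subexponentially many labellings, and each class
  moves into a single fibre: at defects the maps all move to the common net point, elsewhere the
  images in \<open>Y\<close> are close and upper semicontinuity of the fibres applies.\<close>

lemma eventually_elog_sep_near_le:
  fixes G (structure) and \<rho>X :: "'x \<Rightarrow> 'x \<Rightarrow> real" and \<rho>Y :: "'y \<Rightarrow> 'y \<Rightarrow> real"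
  assumes G: "group G" and sof: "sofic_approximation G d \<sigma>"
    and X: "dynamical_system G X a" and Y: "dynamical_system G Y b"
    and p: "factor_map G X a Y b p"
    and \<rho>X: "continuous_pseudometric X \<rho>X" "dynamically_generating G X a \<rho>X"
    and \<rho>Y: "continuous_pseudometric Y \<rho>Y" "dynamically_generating G Y b \<rho>Y"
    and F: "F \<in> nonempty_finite_subsets G" and pos: "0 < \<epsilon>" "0 < \<delta>" "0 < \<gamma>"
  obtains \<theta> F' \<delta>' where "0 < \<theta>" "F' \<in> nonempty_finite_subsets G" "0 < \<delta>'"
    "\<forall>\<^sub>F i in sequentially.
      ereal (1 / real (d i)) *
        elog (sep_near \<rho>X \<rho>Y p (d i) \<epsilon> (sofic_Map X a \<rho>X F' \<delta>' (d i) (\<sigma> i)) \<theta>)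
      \<le> ereal \<gamma> + ereal (1 / real (d i)) *
        elog (sep_fibre \<rho>X p (d i) (\<epsilon> / 2) (sofic_Map X a \<rho>X F \<delta> (d i) (\<sigma> i)))"
proof -
  have F': "F \<subseteq> carrier G" "finite F" "F \<noteq> {}"
    using F unfolding nonempty_finite_subsets_def by auto
  have compX: "compact_space X" using X unfolding dynamical_system_def by blast
  have p_cont: "continuous_map X Y p" and p_surj: "p ` topspace X = topspace Y"
    and p_eq: "\<And>s x. s \<in> carrier G \<Longrightarrow> x \<in> topspace X \<Longrightarrow> p (a s x) = b s (p x)"
    using p unfolding factor_map_def by blast+
  have pY: "p x \<in> topspace Y" if "x \<in> topspace X" for x using p_surj that by blast
  note \<rho>Xc = continuous_pseudometric_continuous[OF \<rho>X(1)]
  note \<rho>Yc = continuous_pseudometric_continuous[OF \<rho>Y(1)]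
  note \<rho>XD = continuous_pseudometricD[OF \<rho>X(1)]
  note \<rho>YD = continuous_pseudometricD[OF \<rho>Y(1)]
  note clX = dynamical_system_closed[OF X]
  note clY = dynamical_system_closed[OF Y]
  \<comment> \<open>The quarters allow for displacement at both ends of a distance, leaving half of
    \<open>\<epsilon>\<close> and using half of \<open>\<delta>\<close>.\<close>
  define \<beta> where "\<beta> = min (\<epsilon> / 4) (\<delta> / 4)"
  have \<beta>: "0 < \<beta>" "\<beta> \<le> \<epsilon> / 4" "\<beta> \<le> \<delta> / 4"
    unfolding \<beta>_def using pos by auto
  \<comment> \<open>The sum bundles \<open>\<rho>X\<close> and its translates by \<open>F\<close>
    into one continuous function vanishing on the diagonal. Its terms are nonnegative, so one bound
    on \<open>W\<close> controls all of them at once.\<close>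
  define W where "W x x' = \<rho>X x x' + (\<Sum>s\<in>F. \<rho>X (a s x) (a s x'))" for x x'
  have act_cont: "continuous_map (prod_topology X X) euclideanreal (\<lambda>(x, y). \<rho>X (a s x) (a s y))"
    if "s \<in> carrier G" for s
    using dynamical_system_continuous[OF X that] dynamical_system_continuous[OF X that] \<rho>Xc
    by (rule continuous_map_pair)
  have "continuous_map (prod_topology X X) euclideanreal (\<lambda>u. \<Sum>s\<in>F. (\<lambda>(x, y). \<rho>X (a s x) (a s y)) u)"
    using F' by (intro continuous_map_sum act_cont) auto
  then have W_cont: "continuous_map (prod_topology X X) euclideanreal (\<lambda>(x, y). W x y)"
    unfolding W_def by (intro continuous_map_add_pair \<rho>Xc) (simp add: case_prod_unfold)
  have nonneg: "0 \<le> \<rho>X (a s x) (a s x')"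
    if "s \<in> F" "x \<in> topspace X" "x' \<in> topspace X" for s x x'
    using \<rho>XD(1) clX F' that by blast
  have W_diag: "W x x < \<beta>" if x: "x \<in> topspace X" for x
  proof -
    have "\<rho>X (a s x) (a s x) = 0" if "s \<in> F" for s
      using \<rho>XD(3) clX F'(1) that x by blast
    then show ?thesis unfolding W_def using \<rho>XD(3)[OF x x] \<beta>(1) by simp
  qed
  have WD: "\<rho>X x x' < \<beta> \<and> (\<forall>s\<in>F. \<rho>X (a s x) (a s x') < \<beta>)"
    if x: "x \<in> topspace X" "x' \<in> topspace X" and W: "W x x' < \<beta>" for x x'
  proof -
    have "0 \<le> (\<Sum>s\<in>F. \<rho>X (a s x) (a s x'))"
      using nonneg x by (intro sum_nonneg) blast
    moreover have "\<rho>X (a s x) (a s x') \<le> (\<Sum>s\<in>F. \<rho>X (a s x) (a s x'))" if "s \<in> F" for s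
      using nonneg x F'(2) that by (intro member_le_sum) auto
    ultimately show ?thesis using W \<rho>XD(1)[OF x] unfolding W_def by force
  qed
  obtain N where N: "finite N" "N \<subseteq> topspace X" "\<And>x. x \<in> topspace X \<Longrightarrow> \<exists>z\<in>N. W z x < \<beta>"
    using compact_space_finite_net[OF compX W_cont W_diag] by blast
  then obtain net where net: "\<And>x. x \<in> topspace X \<Longrightarrow> net x \<in> N \<and> W (net x) x < \<beta>"
    by metis
  obtain \<kappa> where \<kappa>: "0 < \<kappa>"
    and count: "\<And>d. real (card {c \<in> {1..d} \<rightarrow>\<^sub>E insert None (Some ` N).
                      real (card {v \<in> {1..d}. c v \<noteq> None}) \<le> \<kappa> * real d}) \<le> exp (real d * \<gamma>)"
    using card_sparse_labellings_subexponential[OF N(1) pos(3)] by blast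
  have "metrizable_space Y" using Y unfolding dynamical_system_def by blast
  then obtain M dM where M: "Metric_space M dM" and YM: "Y = Metric_space.mtopology M dM"
    unfolding metrizable_space_def by blast
  have M_eq: "M = topspace Y" unfolding YM using Metric_space.topspace_mtopology[OF M] by simp
  obtain r where r: "0 < r" and usc: "\<And>A. A \<subseteq> topspace X \<Longrightarrow>
      (\<And>x x'. x \<in> A \<Longrightarrow> x' \<in> A \<Longrightarrow> dM (p x) (p x') < r) \<Longrightarrow>
      \<exists>y. \<forall>x\<in>A. \<exists>z\<in>topspace X. p z = y \<and> W z x < \<beta>"
    using fibre_upper_semicontinuous[OF compX p_cont p_surj[folded M_eq] M YM W_cont W_diag] by blast
  have dM_cont: "continuous_map (prod_topology Y Y) euclideanreal (\<lambda>(x, y). dM x y)"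
    using continuous_map_metric[of "metric (M, dM)"] M YM
    by (simp add: mtopology_of_def Metric_space.mspace_metric Metric_space.mdist_metric)
  have dM_diag: "dM y y < r" if "y \<in> topspace Y" for y
    using Metric_space.zero[OF M, of y y] that r M_eq by simp
  \<comment> \<open>The scale \<open>r\<close> refers to a metric of \<open>Y\<close>, whereas
    nearness is given in \<open>\<rho>Y\<close>. The finite set \<open>S\<close> of translates
    bridges the two.\<close>
  obtain S \<tau>0 where S: "finite S" "S \<subseteq> carrier G" and \<tau>0: "0 < \<tau>0"
    and control: "\<And>y y'. y \<in> topspace Y \<Longrightarrow> y' \<in> topspace Y \<Longrightarrow>
       (\<And>s. s \<in> S \<Longrightarrow> \<rho>Y (b s y) (b s y') \<le> \<tau>0) \<Longrightarrow> dM y y' < r"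
    using dynamically_generating_control[OF Y \<rho>Y dM_cont dM_diag] by blast
  \<comment> \<open>One third for each step of the later comparison: a defect of each of the two
    maps, and their nearness at the shifted coordinate. The same \<open>\<tau>\<close> serves as
    \<open>\<theta>\<close>.\<close>
  define \<tau> where "\<tau> = \<tau>0 / 3"
  have \<tau>: "0 < \<tau>" unfolding \<tau>_def using \<tau>0 by simp
  have p\<rho>_cont: "continuous_map (prod_topology X X) euclideanreal (\<lambda>(x, y). \<rho>Y (p x) (p y))"
    using p_cont p_cont \<rho>Yc by (rule continuous_map_pair)
  have p\<rho>_diag: "\<rho>Y (p x) (p x) < \<tau>" if "x \<in> topspace X" for x
    using \<rho>YD(3)[OF pY pY] that \<tau> by simp
  \<comment> \<open>Defects are measured in \<open>Y\<close>, by \<open>\<rho>Y\<close> pulled back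
    along \<open>p\<close>, although the maps are only known to be equivariant with respect to
    \<open>\<rho>X\<close>.\<close>
  obtain F1 \<delta>1 where F1: "finite F1" "F1 \<subseteq> carrier G" and \<delta>1: "0 < \<delta>1"
    and defects: "\<forall>\<^sub>F i in sequentially. \<forall>\<phi>\<in>sofic_Map X a \<rho>X F1 \<delta>1 (d i) (\<sigma> i).
       real (card {v \<in> {1..d i}. \<exists>s\<in>S. \<tau> \<le> \<rho>Y (p (a s (\<phi> v))) (p (\<phi> (\<sigma> i s v)))}) \<le> \<kappa> * real (d i)"
    using sofic_Map_few_defects[OF G sof X \<rho>X p\<rho>_cont p\<rho>_diag S \<kappa>] by blast
  define F2 where "F2 = F \<union> F1"
  define \<delta>2 where "\<delta>2 = min (\<delta> / 2) \<delta>1"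
  have "filterlim d at_top sequentially"
    using sof unfolding sofic_approximation_def by blast
  then have dpos: "\<forall>\<^sub>F i in sequentially. 1 \<le> d i"
    by (simp add: filterlim_at_top)
  show ?thesis
  proof
    show "0 < \<tau>" by fact
    show "F2 \<in> nonempty_finite_subsets G"
      using F' F1 unfolding F2_def nonempty_finite_subsets_def by blast
    show "0 < \<delta>2" unfolding \<delta>2_def using \<delta>1 pos by simp
    show "\<forall>\<^sub>F i in sequentially.
      ereal (1 / real (d i)) *
        elog (sep_near \<rho>X \<rho>Y p (d i) \<epsilon> (sofic_Map X a \<rho>X F2 \<delta>2 (d i) (\<sigma> i)) \<tau>)
      \<le> ereal \<gamma> + ereal (1 / real (d i)) *
        elog (sep_fibre \<rho>X p (d i) (\<epsilon> / 2) (sofic_Map X a \<rho>X F \<delta> (d i) (\<sigma> i)))"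
      using defects dpos
    proof eventually_elim
      case (elim i)
      define K where "K = {c \<in> {1..d i} \<rightarrow>\<^sub>E insert None (Some ` N).
                      real (card {v \<in> {1..d i}. c v \<noteq> None}) \<le> \<kappa> * real (d i)}"
      define q where "q = sep_fibre \<rho>X p (d i) (\<epsilon> / 2) (sofic_Map X a \<rho>X F \<delta> (d i) (\<sigma> i))"
      define bad where "bad \<phi> v \<longleftrightarrow> (\<exists>s\<in>S. \<tau> \<le> \<rho>Y (p (a s (\<phi> v))) (p (\<phi> (\<sigma> i s v))))" for \<phi> v
      define lab where "lab \<phi> = restrict (\<lambda>v. if bad \<phi> v then Some (net (\<phi> v)) else None) {1..d i}" for \<phi>
      have d: "0 < d i" using elim by simp
      have per: "\<sigma> i s permutes {1..d i}" if "s \<in> carrier G" for s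
        using sofic_approximation_permutes[OF sof that] .
      have "finite ({1..d i} \<rightarrow>\<^sub>E insert None (Some ` N))"
        using N(1) by (intro finite_PiE) auto
      then have finK: "finite K" unfolding K_def by simp
      have bound: "enat (card E) \<le> of_nat (card K) * q"
        if E: "finite E" "E \<subseteq> sofic_Map X a \<rho>X F2 \<delta>2 (d i) (\<sigma> i)"
          and near: "\<And>\<phi> \<phi>'. \<phi> \<in> E \<Longrightarrow> \<phi>' \<in> E \<Longrightarrow> \<phi> \<noteq> \<phi>' \<Longrightarrow> distinf \<rho>Y (d i) (p \<circ> \<phi>) (p \<circ> \<phi>') \<le> \<tau>"
          and sep: "\<And>\<phi> \<phi>'. \<phi> \<in> E \<Longrightarrow> \<phi>' \<in> E \<Longrightarrow> \<phi> \<noteq> \<phi>' \<Longrightarrow> \<epsilon> \<le> distinf \<rho>X (d i) \<phi> \<phi>'"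
        for E
      proof -
        have EX: "\<phi> v \<in> topspace X" if "\<phi> \<in> E" "v \<in> {1..d i}" for \<phi> v
          using E(2) that unfolding sofic_Map_def by blast
        have EF: "E \<subseteq> sofic_Map X a \<rho>X F (\<delta> / 2) (d i) (\<sigma> i)"
          using E(2) sofic_Map_mono[of F F2 \<delta>2 "\<delta> / 2"] unfolding F2_def \<delta>2_def
          by (meson Un_upper1 min.cobounded1 subset_trans)
        have EF1: "E \<subseteq> sofic_Map X a \<rho>X F1 \<delta>1 (d i) (\<sigma> i)"
          using E(2) sofic_Map_mono[of F1 F2 \<delta>2 \<delta>1] unfolding F2_def \<delta>2_def
          by (meson Un_upper2 min.cobounded2 subset_trans)
        have labK: "lab \<phi> \<in> K" if \<phi>: "\<phi> \<in> E" for \<phi>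
        proof -
          have "{v \<in> {1..d i}. lab \<phi> v \<noteq> None} = {v \<in> {1..d i}. bad \<phi> v}"
            unfolding lab_def by auto
          moreover have "real (card {v \<in> {1..d i}. bad \<phi> v}) \<le> \<kappa> * real (d i)"
            unfolding bad_def using elim(1) EF1 \<phi> by blast
          moreover have "lab \<phi> \<in> {1..d i} \<rightarrow>\<^sub>E insert None (Some ` N)"
            unfolding lab_def using net EX[OF \<phi>] by (intro PiE_I) auto
          ultimately show ?thesis unfolding K_def by simp
        qed
        define C where "C c = {\<phi> \<in> E. lab \<phi> = c}" for c
        have class_le: "enat (card (C c)) \<le> q" for c
          unfolding q_def
        proof (rule sep_fibre_ge_card_of_near_fibre[OF X \<rho>X(1) F'(1) _ d pos(1,2) \<beta>(2,3)])
          show "\<sigma> i s permutes {1..d i}" if "s \<in> F" for s using per F'(1) that by blast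
          show "finite (C c)" "C c \<subseteq> sofic_Map X a \<rho>X F (\<delta> / 2) (d i) (\<sigma> i)"
            unfolding C_def using E(1) EF by auto
          show "\<epsilon> \<le> distinf \<rho>X (d i) \<phi> \<phi>'" if "\<phi> \<in> C c" "\<phi>' \<in> C c" "\<phi> \<noteq> \<phi>'" for \<phi> \<phi>'
            using sep that unfolding C_def by blast
          fix v assume v: "v \<in> {1..d i}"
          have "\<exists>y. \<forall>x\<in>(\<lambda>\<phi>. \<phi> v) ` C c. \<exists>z\<in>topspace X. p z = y \<and> W z x < \<beta>"
          proof (cases "c v")
            \<comment> \<open>The label is itself the destination: the common base point is
              \<open>p z\<close>, and \<open>z\<close> is the witness for every map of the
              class.\<close>
            case (Some z)
            have "z \<in> topspace X \<and> W z (\<phi> v) < \<beta>" if \<phi>: "\<phi> \<in> C c" for \<phi>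
            proof -
              have "lab \<phi> v = Some z" "\<phi> \<in> E" using \<phi> Some unfolding C_def by auto
              then have "z = net (\<phi> v)" unfolding lab_def using v by (auto split: if_splits)
              then show ?thesis using net EX[OF \<open>\<phi> \<in> E\<close> v] N(2) by blast
            qed
            then show ?thesis by blast
          next
            case None
            show ?thesis
            proof (rule usc)
              show "(\<lambda>\<phi>. \<phi> v) ` C c \<subseteq> topspace X" unfolding C_def using EX v by blast
              fix x x' assume "x \<in> (\<lambda>\<phi>. \<phi> v) ` C c" "x' \<in> (\<lambda>\<phi>. \<phi> v) ` C c"
              then obtain \<phi> \<phi>' where x: "x = \<phi> v" "x' = \<phi>' v" and "\<phi> \<in> C c" "\<phi>' \<in> C c" by blast
              then have \<phi>: "\<phi> \<in> E" "\<phi>' \<in> E" "lab \<phi> v = None" "lab \<phi>' v = None"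
                using None unfolding C_def by auto
              then have good: "\<not> bad \<phi> v" "\<not> bad \<phi>' v"
                unfolding lab_def using v by (auto split: if_splits)
              note mem = EX[OF \<phi>(1) v] EX[OF \<phi>(2) v]
              have "\<rho>Y (b s (p (\<phi> v))) (b s (p (\<phi>' v))) \<le> \<tau>0" if s: "s \<in> S" for s
              proof -
                have sG: "s \<in> carrier G" using s S by blast
                then have sv: "\<sigma> i s v \<in> {1..d i}" using permutes_in_image[OF per] v by blast
                note smem = pY[OF EX[OF \<phi>(1) sv]] pY[OF EX[OF \<phi>(2) sv]]
                note amem = pY[OF clX[OF sG mem(1)]] pY[OF clX[OF sG mem(2)]]
                have 1: "\<rho>Y (p (a s (\<phi> v))) (p (\<phi> (\<sigma> i s v))) < \<tau>"
                  "\<rho>Y (p (a s (\<phi>' v))) (p (\<phi>' (\<sigma> i s v))) < \<tau>"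
                  using good s unfolding bad_def by force+
                \<comment> \<open>Nearness is assumed only for distinct maps, so equal ones are
                  treated apart.\<close>
                have 2: "\<rho>Y (p (\<phi> (\<sigma> i s v))) (p (\<phi>' (\<sigma> i s v))) \<le> \<tau>"
                proof (cases "\<phi> = \<phi>'")
                  case True
                  then show ?thesis using \<rho>YD(3)[OF smem(1) smem(1)] \<tau> by simp
                next
                  case False
                  then show ?thesis
                    using near[OF \<phi>(1,2) False] distinf_ge[OF sv, of \<rho>Y "p \<circ> \<phi>" "p \<circ> \<phi>'"] by simp
                qed
                \<comment> \<open>The chain leaves \<open>v\<close> along \<open>s\<close> for the
                  coordinate \<open>\<sigma> i s v\<close>, passes there from \<open>\<phi>\<close>
                  to \<open>\<phi>'\<close>, and returns; equivariance of \<open>p\<close> turns its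
                  ends into translates in \<open>Y\<close>.\<close>
                have "\<rho>Y (p (a s (\<phi> v))) (p (a s (\<phi>' v)))
                    \<le> \<rho>Y (p (a s (\<phi> v))) (p (\<phi> (\<sigma> i s v))) + \<rho>Y (p (\<phi> (\<sigma> i s v))) (p (a s (\<phi>' v)))"
                  by (rule \<rho>YD(4)[OF amem(1) smem(1) amem(2)])
                also have "\<rho>Y (p (\<phi> (\<sigma> i s v))) (p (a s (\<phi>' v)))
                    \<le> \<rho>Y (p (\<phi> (\<sigma> i s v))) (p (\<phi>' (\<sigma> i s v))) + \<rho>Y (p (\<phi>' (\<sigma> i s v))) (p (a s (\<phi>' v)))"
                  by (rule \<rho>YD(4)[OF smem amem(2)])
                also have "\<rho>Y (p (\<phi>' (\<sigma> i s v))) (p (a s (\<phi>' v))) = \<rho>Y (p (a s (\<phi>' v))) (p (\<phi>' (\<sigma> i s v)))"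
                  by (rule \<rho>YD(2)[OF smem(2) amem(2)])
                finally show ?thesis
                  using 1 2 unfolding p_eq[OF sG mem(1)] p_eq[OF sG mem(2)] \<tau>_def by simp
              qed
              then show "dM (p x) (p x') < r"
                unfolding x using control pY mem by blast
            qed
          qed
          then obtain y where "\<forall>x\<in>(\<lambda>\<phi>. \<phi> v) ` C c. \<exists>z\<in>topspace X. p z = y \<and> W z x < \<beta>" by blast
          then show "\<exists>y. \<forall>\<phi>\<in>C c. \<exists>z\<in>topspace X. p z = y \<and>
              \<rho>X z (\<phi> v) < \<beta> \<and> (\<forall>s\<in>F. \<rho>X (a s z) (a s (\<phi> v)) < \<beta>)"
            using WD EX v unfolding C_def by blast
        qed
        have "E \<subseteq> (\<Union>c\<in>K. C c)" unfolding C_def using labK by blast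
        then have "card E \<le> card (\<Union>c\<in>K. C c)"
          using finK E(1) by (intro card_mono) (auto simp: C_def)
        also have "\<dots> \<le> (\<Sum>c\<in>K. card (C c))" by (rule card_UN_le[OF finK])
        finally have "enat (card E) \<le> of_nat (\<Sum>c\<in>K. card (C c))" by (simp add: of_nat_eq_enat)
        also have "\<dots> = (\<Sum>c\<in>K. enat (card (C c)))" unfolding of_nat_sum by (simp add: of_nat_eq_enat)
        also have "\<dots> \<le> (\<Sum>c\<in>K. q)" by (rule sum_mono) (rule class_le)
        also have "\<dots> = of_nat (card K) * q" by simp
        finally show ?thesis .
      qed
      have "sep_near \<rho>X \<rho>Y p (d i) \<epsilon> (sofic_Map X a \<rho>X F2 \<delta>2 (d i) (\<sigma> i)) \<tau> \<le> of_nat (card K) * q"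
        unfolding sep_near_def by (rule SUP_least, elim CollectE conjE, rule bound) blast+
      then show ?case
        unfolding q_def using count[of "d i", folded K_def] d by (rule elog_mult_le)
    qed
  qed
qed

section \<open>Comparison of the two entropies at fixed scales\<close>

lemma h_near_le_h_fibre:
  fixes G (structure) and \<rho>X :: "'x \<Rightarrow> 'x \<Rightarrow> real" and \<rho>Y :: "'y \<Rightarrow> 'y \<Rightarrow> real"
  assumes "group G" "sofic_approximation G d \<sigma>"
    and "dynamical_system G X a" "dynamical_system G Y b" "factor_map G X a Y b p"
    and "continuous_pseudometric X \<rho>X" "dynamically_generating G X a \<rho>X"
    and "continuous_pseudometric Y \<rho>Y" "dynamically_generating G Y b \<rho>Y"
    and "0 < \<epsilon>"
  shows "h_near G d \<sigma> X a p \<rho>X \<rho>Y \<epsilon> \<le> h_fibre G d \<sigma> X a p \<rho>X (\<epsilon> / 2)"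
  unfolding h_fibre_def
proof (intro INF_greatest)
  fix F and \<delta> :: real assume F: "F \<in> nonempty_finite_subsets G" and "\<delta> \<in> {0<..}"
  then have \<delta>: "0 < \<delta>" by simp
  define u where "u i = ereal (1 / real (d i)) *
    elog (sep_fibre \<rho>X p (d i) (\<epsilon> / 2) (sofic_Map X a \<rho>X F \<delta> (d i) (\<sigma> i)))" for i
  \<comment> \<open>The parameters obtained depend on \<open>\<gamma>\<close>, but
    \<open>h_near\<close> is an infimum over them, so \<open>\<gamma>\<close> can tend to 0
    afterwards.\<close>
  have "h_near G d \<sigma> X a p \<rho>X \<rho>Y \<epsilon> \<le> limsup u + ereal \<gamma>" if \<gamma>: "0 < \<gamma>" for \<gamma>
  proof -
    obtain \<theta> F' \<delta>' where *: "0 < \<theta>" "F' \<in> nonempty_finite_subsets G" "0 < \<delta>'"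
      and ev: "\<forall>\<^sub>F i in sequentially.
        ereal (1 / real (d i)) *
          elog (sep_near \<rho>X \<rho>Y p (d i) \<epsilon> (sofic_Map X a \<rho>X F' \<delta>' (d i) (\<sigma> i)) \<theta>)
        \<le> ereal \<gamma> + u i"
      unfolding u_def
      using eventually_elog_sep_near_le[OF assms(1-9) F assms(10) \<delta> \<gamma>] by blast
    have "h_near G d \<sigma> X a p \<rho>X \<rho>Y \<epsilon> \<le> limsup (\<lambda>i. ereal (1 / real (d i)) *
          elog (sep_near \<rho>X \<rho>Y p (d i) \<epsilon> (sofic_Map X a \<rho>X F' \<delta>' (d i) (\<sigma> i)) \<theta>))"
      unfolding h_near_def
      by (rule INF_lower2[of \<theta>], use * in simp, rule INF_lower2[of F'], use * in simp,
          rule INF_lower[of \<delta>'], use * in simp)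
    also have "\<dots> \<le> limsup (\<lambda>i. ereal \<gamma> + u i)" by (rule Limsup_mono[OF ev])
    also have "\<dots> = limsup u + ereal \<gamma>" by (subst Limsup_add_ereal_left) (auto simp: add.commute)
    finally show ?thesis .
  qed
  then have "h_near G d \<sigma> X a p \<rho>X \<rho>Y \<epsilon> \<le> limsup u"
    by (rule ereal_le_epsilon2)
  then show "h_near G d \<sigma> X a p \<rho>X \<rho>Y \<epsilon> \<le> limsup (\<lambda>i. ereal (1 / real (d i)) *
    elog (sep_fibre \<rho>X p (d i) (\<epsilon> / 2) (sofic_Map X a \<rho>X F \<delta> (d i) (\<sigma> i))))"
    unfolding u_def .
qed

text \<open>Equal images are at distance 0, hence \<open>\<theta>\<close>-near. Positivity of
  \<open>d\<close> makes the maximum in \<open>distinf\<close> range over a nonempty set.\<close>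

lemma sep_fibre_le_sep_near:
  assumes d: "0 < d" and \<theta>: "0 < \<theta>" and K: "K \<subseteq> {1..d} \<rightarrow>\<^sub>E topspace X"
    and p: "p ` topspace X \<subseteq> topspace Y" and \<rho>Y: "continuous_pseudometric Y \<rho>Y"
  shows "sep_fibre \<rho>X p d \<epsilon> K \<le> sep_near \<rho>X \<rho>Y p d \<epsilon> K \<theta>"
  unfolding sep_fibre_def sep_near_def
proof (rule SUP_subset_mono)
  have le: "distinf \<rho>Y d (p \<circ> \<phi>) (p \<circ> \<phi>') \<le> \<theta>"
    if \<phi>: "\<phi> \<in> K" "compose {1..d} p \<phi> = compose {1..d} p \<phi>'" for \<phi> \<phi>'
  proof -
    obtain v where v: "v \<in> {1..d}" "distinf \<rho>Y d (p \<circ> \<phi>) (p \<circ> \<phi>') = \<rho>Y (p (\<phi> v)) (p (\<phi>' v))"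
      using distinf_attained[OF d, of \<rho>Y "p \<circ> \<phi>" "p \<circ> \<phi>'"] by auto
    have "p (\<phi> v) = p (\<phi>' v)" using fun_cong[OF \<phi>(2), of v] v(1) by (simp add: compose_def)
    moreover have "p (\<phi> v) \<in> topspace Y" using \<phi>(1) K v(1) p by blast
    ultimately show ?thesis using continuous_pseudometricD(3)[OF \<rho>Y] v(2) \<theta> by force
  qed
  show "{E. finite E \<and> E \<subseteq> K \<and> (\<forall>\<phi>\<in>E. \<forall>\<phi>'\<in>E. \<phi> \<noteq> \<phi>' \<longrightarrow>
          compose {1..d} p \<phi> = compose {1..d} p \<phi>' \<and> \<epsilon> \<le> distinf \<rho>X d \<phi> \<phi>')}
      \<subseteq> {E. finite E \<and> E \<subseteq> K \<and> (\<forall>\<phi>\<in>E. \<forall>\<phi>'\<in>E. \<phi> \<noteq> \<phi>' \<longrightarrow>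
          distinf \<rho>Y d (p \<circ> \<phi>) (p \<circ> \<phi>') \<le> \<theta> \<and> \<epsilon> \<le> distinf \<rho>X d \<phi> \<phi>')}"
    using le by (intro Collect_mono impI) (meson subsetD)
qed simp

lemma h_fibre_le_h_near:
  assumes sof: "sofic_approximation G d \<sigma>" and p: "factor_map G X a Y b p"
    and \<rho>Y: "continuous_pseudometric Y \<rho>Y"
  shows "h_fibre G d \<sigma> X a p \<rho>X \<epsilon> \<le> h_near G d \<sigma> X a p \<rho>X \<rho>Y \<epsilon>"
  unfolding h_near_def
proof (intro INF_greatest)
  fix \<theta> :: real and F and \<delta> :: real
  assume *: "\<theta> \<in> {0<..}" "F \<in> nonempty_finite_subsets G" "\<delta> \<in> {0<..}"
  have "filterlim d at_top sequentially"
    using sof unfolding sofic_approximation_def by blast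
  then have dpos: "\<forall>\<^sub>F i in sequentially. 1 \<le> d i"
    by (simp add: filterlim_at_top)
  have "h_fibre G d \<sigma> X a p \<rho>X \<epsilon> \<le> limsup (\<lambda>i. ereal (1 / real (d i)) *
          elog (sep_fibre \<rho>X p (d i) \<epsilon> (sofic_Map X a \<rho>X F \<delta> (d i) (\<sigma> i))))"
    unfolding h_fibre_def by (rule INF_lower2[OF *(2)], rule INF_lower[OF *(3)])
  also have "\<dots> \<le> limsup (\<lambda>i. ereal (1 / real (d i)) *
          elog (sep_near \<rho>X \<rho>Y p (d i) \<epsilon> (sofic_Map X a \<rho>X F \<delta> (d i) (\<sigma> i)) \<theta>))"
  proof (rule Limsup_mono)
    show "\<forall>\<^sub>F i in sequentially. ereal (1 / real (d i)) *
          elog (sep_fibre \<rho>X p (d i) \<epsilon> (sofic_Map X a \<rho>X F \<delta> (d i) (\<sigma> i)))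
        \<le> ereal (1 / real (d i)) *
          elog (sep_near \<rho>X \<rho>Y p (d i) \<epsilon> (sofic_Map X a \<rho>X F \<delta> (d i) (\<sigma> i)) \<theta>)"
      using dpos
    proof eventually_elim
      case (elim i)
      have "sofic_Map X a \<rho>X F \<delta> (d i) (\<sigma> i) \<subseteq> {1..d i} \<rightarrow>\<^sub>E topspace X"
        unfolding sofic_Map_def by (rule Collect_restrict)
      moreover have "p ` topspace X \<subseteq> topspace Y" using p unfolding factor_map_def by blast
      ultimately show ?case
        using elim *(1) \<rho>Y by (intro ereal_mult_left_mono elog_mono sep_fibre_le_sep_near) auto
    qed
  qed
  finally show "h_fibre G d \<sigma> X a p \<rho>X \<epsilon> \<le> limsup (\<lambda>i. ereal (1 / real (d i)) *
          elog (sep_near \<rho>X \<rho>Y p (d i) \<epsilon> (sofic_Map X a \<rho>X F \<delta> (d i) (\<sigma> i)) \<theta>))" .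
qed

section \<open>Growth rates and metric mean dimension\<close>

text \<open>The logarithm of a positive integer is nonnegative, so a negative limit superior forces
  the terms to be eventually \<open>-\<infinity>\<close>. The dichotomy is what later allows
  enlarging by a factor above 1.\<close>

lemma limsup_elog_cases:
  fixes n :: "nat \<Rightarrow> enat" and d :: "nat \<Rightarrow> nat"
  defines "u \<equiv> \<lambda>i. ereal (1 / real (d i)) * elog (n i)"
  shows "limsup u = -\<infinity> \<or> 0 \<le> limsup u"
proof (rule disjCI)
  assume "\<not> 0 \<le> limsup u"
  then have "\<forall>\<^sub>F i in sequentially. u i < 0" by (intro Limsup_lessD) simp
  then have "\<forall>\<^sub>F i in sequentially. u i = -\<infinity>"
  proof eventually_elim
    case (elim i)
    have "0 \<le> ereal (1 / real (d i))" by simp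
    then have "\<not> 0 \<le> elog (n i)"
      using elim unfolding u_def by (meson ereal_zero_le_0_iff not_less)
    then have "elog (n i) = -\<infinity>" using elog_cases by blast
    \<comment> \<open>Here \<open>1 / real 0 = 0\<close> and \<open>0 * -\<infinity> = 0\<close>, so
      a term with \<open>d i = 0\<close> is not negative.\<close>
    moreover have "d i \<noteq> 0"
    proof
      assume "d i = 0"
      then show False using elim unfolding u_def by (simp add: zero_ereal_def[symmetric])
    qed
    ultimately show ?case unfolding u_def by simp
  qed
  then have "limsup u = limsup (\<lambda>i. -\<infinity>)" by (rule Limsup_eq)
  then show "limsup u = -\<infinity>" by (simp add: Limsup_const)
qed

lemma h_fibre_cases:
  "h_fibre G d \<sigma> X a p \<rho>X \<epsilon> = -\<infinity> \<or> 0 \<le> h_fibre G d \<sigma> X a p \<rho>X \<epsilon>"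
proof (rule disjCI)
  assume "\<not> 0 \<le> h_fibre G d \<sigma> X a p \<rho>X \<epsilon>"
  then obtain F \<delta> where *: "F \<in> nonempty_finite_subsets G" "\<delta> \<in> {0<..}"
    and "\<not> 0 \<le> limsup (\<lambda>i. ereal (1 / real (d i)) *
          elog (sep_fibre \<rho>X p (d i) \<epsilon> (sofic_Map X a \<rho>X F \<delta> (d i) (\<sigma> i))))"
    unfolding h_fibre_def by (auto simp: le_INF_iff)
  then have "limsup (\<lambda>i. ereal (1 / real (d i)) *
          elog (sep_fibre \<rho>X p (d i) \<epsilon> (sofic_Map X a \<rho>X F \<delta> (d i) (\<sigma> i)))) = -\<infinity>"
    using limsup_elog_cases[of d "\<lambda>i. sep_fibre \<rho>X p (d i) \<epsilon> (sofic_Map X a \<rho>X F \<delta> (d i) (\<sigma> i))"]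
    by blast
  moreover have "h_fibre G d \<sigma> X a p \<rho>X \<epsilon> \<le> limsup (\<lambda>i. ereal (1 / real (d i)) *
          elog (sep_fibre \<rho>X p (d i) \<epsilon> (sofic_Map X a \<rho>X F \<delta> (d i) (\<sigma> i))))"
    unfolding h_fibre_def by (rule INF_lower2[OF *(1)], rule INF_lower[OF *(2)])
  ultimately show "h_fibre G d \<sigma> X a p \<rho>X \<epsilon> = -\<infinity>" by simp
qed

lemma ereal_le_of_le_mult:
  fixes x y :: ereal
  assumes "\<And>K. 1 < K \<Longrightarrow> x \<le> ereal K * y"
  shows "x \<le> y"
proof (cases y)
  case (real r)
  have "((\<lambda>K. ereal (K * r)) \<longlongrightarrow> ereal (1 * r)) (at_right 1)"
    by (intro tendsto_intros)
  moreover have "\<forall>\<^sub>F K in at_right 1. x \<le> ereal (K * r)"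
    using assms real by (intro eventually_at_right_less[THEN eventually_mono]) auto
  ultimately have "x \<le> ereal (1 * r)" by (rule tendsto_lowerbound) simp
  then show ?thesis using real by simp
next
  case MInf
  then show ?thesis using assms[of 2] by simp
qed simp

text \<open>Since \<open>ln (2 / \<epsilon>) / ln (1 / \<epsilon>)\<close> tends to 1, halving the
  scale costs only a factor \<open>K\<close> arbitrarily close to 1. Enlarging the divisor lowers a
  nonnegative \<open>g\<close> by at most that factor and leaves \<open>-\<infinity>\<close>
  unchanged; other negative values would break the estimate.\<close>

lemma Liminf_log_scale_le:
  fixes f g :: "real \<Rightarrow> ereal"
  assumes le: "\<And>\<epsilon>. 0 < \<epsilon> \<Longrightarrow> f \<epsilon> \<le> g (\<epsilon> / 2)" and g: "\<And>\<epsilon>. g \<epsilon> = -\<infinity> \<or> 0 \<le> g \<epsilon>"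
  shows "Liminf (at_right 0) (\<lambda>\<epsilon>. f \<epsilon> / ereal (ln (1 / \<epsilon>)))
       \<le> Liminf (at_right 0) (\<lambda>\<epsilon>. g \<epsilon> / ereal (ln (1 / \<epsilon>)))"
proof (rule ereal_le_of_le_mult)
  fix K :: real assume K: "1 < K"
  let ?g = "\<lambda>\<epsilon>. g \<epsilon> / ereal (ln (1 / \<epsilon>))"
  \<comment> \<open>The exponential threshold gives
    \<open>ln 2 \<le> (K - 1) * ln (1 / \<epsilon>)\<close>, that is,
    \<open>ln (2 / \<epsilon>) \<le> K * ln (1 / \<epsilon>)\<close>.\<close>
  have bound: "f \<epsilon> / ereal (ln (1 / \<epsilon>)) \<le> ereal K * ?g (1 / 2 * \<epsilon>)"
    if \<epsilon>: "0 < \<epsilon>" "\<epsilon> < 1" "\<epsilon> < exp (- ln 2 / (K - 1))" for \<epsilon>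
  proof -
    define l where "l = ln (1 / \<epsilon>)"
    define l' where "l' = ln (1 / (\<epsilon> / 2))"
    have l: "0 < l" unfolding l_def using \<epsilon> by simp
    have l': "l' = l + ln 2" unfolding l_def l'_def using \<epsilon> by (simp add: ln_div)
    have "ln \<epsilon> < - ln 2 / (K - 1)" using \<epsilon> by (metis ln_exp ln_less_cancel_iff exp_gt_zero)
    then have "ln 2 / (K - 1) < l" unfolding l_def using \<epsilon> by (simp add: ln_div)
    then have "ln 2 \<le> (K - 1) * l" using K by (simp add: field_simps)
    then have l'K: "l' \<le> K * l" unfolding l' by (simp add: algebra_simps)
    have "0 < l'" unfolding l' using l by (simp add: add_pos_pos)
    have "f \<epsilon> / ereal l \<le> g (\<epsilon> / 2) / ereal l"
      using le[OF \<epsilon>(1)] l by (intro ereal_divide_right_mono) auto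
    also have "\<dots> \<le> ereal K * (g (\<epsilon> / 2) / ereal l')"
    proof (cases "g (\<epsilon> / 2)")
      case (real r)
      then have "0 \<le> r" using g[of "\<epsilon> / 2"] by auto
      then have "r * l' \<le> r * (K * l)" using l'K by (intro mult_left_mono)
      then have "r / l \<le> K * (r / l')" using l \<open>0 < l'\<close> by (simp add: field_simps)
      then show ?thesis using real l \<open>0 < l'\<close> by simp
    next
      case PInf
      then show ?thesis using K \<open>0 < l'\<close> by (simp add: divide_ereal_def)
    next
      case MInf
      then show ?thesis using l by (simp add: divide_ereal_def)
    qed
    finally show ?thesis unfolding l_def l'_def by simp
  qed
  have "\<forall>\<^sub>F \<epsilon> in at_right 0. \<epsilon> \<in> {0<..<min 1 (exp (- ln 2 / (K - 1)))}"
    by (rule eventually_at_right_real) simp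
  then have "\<forall>\<^sub>F \<epsilon> in at_right 0. f \<epsilon> / ereal (ln (1 / \<epsilon>)) \<le> ereal K * ?g (1 / 2 * \<epsilon>)"
    by eventually_elim (rule bound, auto)
  then have "Liminf (at_right 0) (\<lambda>\<epsilon>. f \<epsilon> / ereal (ln (1 / \<epsilon>)))
      \<le> Liminf (at_right 0) (\<lambda>\<epsilon>. ereal K * ?g (1 / 2 * \<epsilon>))"
    by (rule Liminf_mono)
  also have "\<dots> = ereal K * Liminf (at_right 0) (\<lambda>\<epsilon>. ?g (1 / 2 * \<epsilon>))"
    using K by (intro Liminf_ereal_mult_left) auto
  \<comment> \<open>The substitution of \<open>\<epsilon> / 2\<close> for \<open>\<epsilon>\<close>
    preserves the filter of right neighbourhoods of 0, so the lower limit is unaffected.\<close>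
  also have "Liminf (at_right 0) (\<lambda>\<epsilon>. ?g (1 / 2 * \<epsilon>)) = Liminf (filtermap (times (1 / 2)) (at_right 0)) ?g"
    by (rule Liminf_filtermap_eq[symmetric]) (simp add: inj_on_def)
  also have "filtermap (times (1 / 2)) (at_right 0) = at_right (0 :: real)"
    using filtermap_times_pos_at_right[of "1 / 2 :: real" 0] by simp
  finally show "Liminf (at_right 0) (\<lambda>\<epsilon>. f \<epsilon> / ereal (ln (1 / \<epsilon>)))
      \<le> ereal K * Liminf (at_right 0) ?g" .
qed

theorem theorem6p5:
  fixes G :: "('g, 'm) monoid_scheme"
    and d :: "nat \<Rightarrow> nat" and \<sigma> :: "nat \<Rightarrow> 'g \<Rightarrow> nat \<Rightarrow> nat"
    and X :: "'x topology" and a :: "'g \<Rightarrow> 'x \<Rightarrow> 'x"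
    and Y :: "'y topology" and b :: "'g \<Rightarrow> 'y \<Rightarrow> 'y"
    and p :: "'x \<Rightarrow> 'y"
    and \<rho>X :: "'x \<Rightarrow> 'x \<Rightarrow> real" and \<rho>Y :: "'y \<Rightarrow> 'y \<Rightarrow> real"
  assumes "group G" and "countable (carrier G)"
    and "sofic_approximation G d \<sigma>"
    and "dynamical_system G X a" and "dynamical_system G Y b"
    and "factor_map G X a Y b p"
    and "continuous_pseudometric X \<rho>X" and "dynamically_generating G X a \<rho>X"
    and "continuous_pseudometric Y \<rho>Y" and "dynamically_generating G Y b \<rho>Y"
  shows "mdim_near G d \<sigma> X a p \<rho>X \<rho>Y = mdim_fibre G d \<sigma> X a p \<rho>X"
proof (rule antisym)
  show "mdim_near G d \<sigma> X a p \<rho>X \<rho>Y \<le> mdim_fibre G d \<sigma> X a p \<rho>X"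
    unfolding mdim_near_def mdim_fibre_def
    using h_near_le_h_fibre[OF assms(1,3-10)] h_fibre_cases by (rule Liminf_log_scale_le)
  have "\<forall>\<^sub>F \<epsilon> in at_right 0. h_fibre G d \<sigma> X a p \<rho>X \<epsilon> / ereal (ln (1 / \<epsilon>))
      \<le> h_near G d \<sigma> X a p \<rho>X \<rho>Y \<epsilon> / ereal (ln (1 / \<epsilon>))"
    using eventually_at_right_real[OF zero_less_one]
  proof eventually_elim
    case (elim \<epsilon>)
    \<comment> \<open>For \<open>\<epsilon>\<close> below 1 the divisor
      \<open>ln (1 / \<epsilon>)\<close> is positive, so division preserves the order.\<close>
    then show ?case
      using h_fibre_le_h_near[OF assms(3,6,9)] by (intro ereal_divide_right_mono) auto
  qed
  then show "mdim_fibre G d \<sigma> X a p \<rho>X \<le> mdim_near G d \<sigma> X a p \<rho>X \<rho>Y"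
    unfolding mdim_near_def mdim_fibre_def by (rule Liminf_mono)
qed

end
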